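(* Let $(G,S)$ be an arbitrary Coxeter system (not necessarily irreducible) with $S=\{s_0,\dots,s_{n-1}\}$ and Coxeter matrix $\mathfrak{m}=(m_{ij})_{0\le i,j\le n-1}$, let $\mathcal{G}$ be its Coxeter graph and let $\mathcal{G}^c$ be a connected extension of $\mathcal{G}$. For every edge of $\mathcal{G}^c$ (virtual or not) with endpoints $i<j$, oriented from $i$ to $j$, introduce a generator $r_{ij}$, and write $r_{ji}:=r_{ij}^{-1}$. Then the alternating subgroup $G^+$ of $G$ is isomorphic to the group generated by the $r_{ij}$ with the defining relations $$\left\{\begin{array}{ll} (r_{ij})^{m_{ij}}=1 & \text{for all generators } r_{ij},\\ r_{ii_1}r_{i_1i_2}\cdots r_{i_ai}=1 & \text{for cycles of } \mathcal{G}^c \text{ with edges } (i i_1),(i_1i_2),\dots,(i_ai),\\ (r_{ij}r_{jk})^2=1 & \text{for } r_{ij},r_{jk} \text{ such that } i<k \text{ and } m_{ik}=2,\\ (r_{ij}r_{jk}r_{kl})^2=1 & \text{for } r_{ij},r_{jk},r_{kl} \text{ such that } i<l \text{ and } m_{il}=2,\\ r_{ij}r_{lm}=r_{lm}r_{ij} & \text{for } r_{ij} \text{ and } r_{lm} \text{ which are not connected.} \end{array}\right.$$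
   Context: A Coxeter system $(G,S)$ with $S=\{s_0,\dots,s_{n-1}\}$ is given by a symmetric matrix $\mathfrak{m}=(m_{ij})_{i,j=0,\dots,n-1}$ with $m_{ii}=1$ and $m_{ij}\in\{2,3,\dots\}\cup\{\infty\}$ for $i\ne j$, and $G=\langle s_0,\dots,s_{n-1}\mid (s_is_j)^{m_{ij}}=1,\ i\le j\rangle$. A relation with exponent $m_{ij}=\infty$ is understood to be omitted (here and in the presentation of the claim). The Coxeter graph $\mathcal{G}$ has vertices $0,\dots,n-1$, with an edge between $i$ and $j$ if and only if $m_{ij}\ge 3$. The alternating subgroup is $G^+:=\ker(\epsilon)$, where $\epsilon:G\to\{-1,1\}$ is the homomorphism with $\epsilon(s_i)=-1$ for all $i$. Connected extension: let $\mathcal{G}=\mathcal{G}_1\sqcup\dots\sqcup\mathcal{G}_m$ be the decomposition into connected components (numbered in any order). For $a=1,\dots,m$ choose an arbitrary vertex $i_a$ of $\mathcal{G}_a$; then for each $l=1,\dots,m-1$ add a "virtual" edge between $i_l$ and $i_{l+1}$, labeled by $2$ (consistently with $m_{i_li_{l+1}}=2$). The resulting connected graph $\mathcal{G}^c$ is called a connected extension of $\mathcal{G}$; it depends on the choices made. If $\mathcal{G}$ is connected, $\mathcal{G}^c=\mathcal{G}$. In the relations, $r_{ij}$ may denote either a generator (if $i<j$) or the inverse of a generator (if $i>j$, $r_{ij}=r_{ji}^{-1}$); it is defined whenever $\{i,j\}$ is an edge (virtual or not) of $\mathcal{G}^c$. Two generators $r_{ij}$ and $r_{lm}$ are said to be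 not connected if $\{i,j\}\cap\{l,m\}=\varnothing$ and there is no edge or virtual edge of $\mathcal{G}^c$ connecting any of the vertices $i,j$ with any of the vertices $l,m$. *)

theory Defs
  imports "HOL-Algebra.Sym_Groups" "HOL-Library.Extended_Nat"
begin

subsection \<open>Groups given by generators and relations\<close>

text \<open>A letter \<open>(x, True)\<close> stands for the generator \<open>x\<close>, the letter \<open>(x, False)\<close> for its formal
  inverse. A relation \<open>u = v\<close> is a pair of words \<open>(u, v)\<close>.\<close>

type_synonym 'a word = "('a \<times> bool) list"

abbreviation words :: "'a set \<Rightarrow> 'a word set" where
  "words X \<equiv> lists (X \<times> UNIV)"

definition word_pow :: "'a word \<Rightarrow> nat \<Rightarrow> 'a word" where
  "word_pow w k = concat (replicate k w)"

inductive pres_eq :: "'a set \<Rightarrow> ('a word \<times> 'a word) set \<Rightarrow> 'a word \<Rightarrow> 'a word \<Rightarrow> bool"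
  for X :: "'a set" and R :: "('a word \<times> 'a word) set" where
  refl: "u \<in> words X \<Longrightarrow> pres_eq X R u u"
| sym: "pres_eq X R u v \<Longrightarrow> pres_eq X R v u"
| trans: "pres_eq X R u v \<Longrightarrow> pres_eq X R v w \<Longrightarrow> pres_eq X R u w"
| append: "pres_eq X R u u' \<Longrightarrow> pres_eq X R v v' \<Longrightarrow> pres_eq X R (u @ v) (u' @ v')"
| cancel: "x \<in> X \<Longrightarrow> pres_eq X R [(x, b), (x, \<not> b)] []"
| rel: "(u, v) \<in> R \<Longrightarrow> u \<in> words X \<Longrightarrow> v \<in> words X \<Longrightarrow> pres_eq X R u v"

definition pres_class :: "'a set \<Rightarrow> ('a word \<times> 'a word) set \<Rightarrow> 'a word \<Rightarrow> 'a word set" where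
  "pres_class X R u = {v. pres_eq X R u v}"

definition presented_group :: "'a set \<Rightarrow> ('a word \<times> 'a word) set \<Rightarrow> 'a word set monoid" where
  "presented_group X R =
    \<lparr>carrier = pres_class X R ` words X,
     mult = (\<lambda>A B. \<Union>u\<in>A. \<Union>v\<in>B. pres_class X R (u @ v)),
     one = pres_class X R []\<rparr>"

lemma pres_eq_words:
  assumes "pres_eq X R u v"
  shows "u \<in> words X \<and> v \<in> words X"
  using assms by induction auto

lemma pres_class_eq_iff:
  assumes "u \<in> words X"
  shows "pres_class X R u = pres_class X R v \<longleftrightarrow> pres_eq X R u v"
proof
  assume "pres_class X R u = pres_class X R v"
  moreover have "u \<in> pres_class X R u"
    using assms by (simp add: pres_class_def pres_eq.refl)
  ultimately show "pres_eq X R u v"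
    by (auto simp: pres_class_def intro: pres_eq.sym)
next
  assume "pres_eq X R u v"
  then show "pres_class X R u = pres_class X R v"
    unfolding pres_class_def by (blast intro: pres_eq.sym pres_eq.trans)
qed

lemma presented_group_mult:
  assumes u: "u \<in> words X" and v: "v \<in> words X"
  shows "pres_class X R u \<otimes>\<^bsub>presented_group X R\<^esub> pres_class X R v = pres_class X R (u @ v)"
proof -
  have "pres_class X R (u' @ v') = pres_class X R (u @ v)"
    if "u' \<in> pres_class X R u" "v' \<in> pres_class X R v" for u' v'
  proof -
    have "pres_eq X R (u @ v) (u' @ v')"
      using that by (simp add: pres_class_def pres_eq.append)
    moreover have "u @ v \<in> words X" using u v by simp
    ultimately show ?thesis using pres_class_eq_iff[of "u @ v" X R] by blast
  qed
  moreover have "u \<in> pres_class X R u" "v \<in> pres_class X R v"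
    using u v by (simp_all add: pres_class_def pres_eq.refl)
  ultimately have "(\<Union>u'\<in>pres_class X R u. \<Union>v'\<in>pres_class X R v. pres_class X R (u' @ v')) =
      pres_class X R (u @ v)"
    by blast
  then show ?thesis by (simp add: presented_group_def)
qed

definition inv_word :: "'a word \<Rightarrow> 'a word" where
  "inv_word w = rev (map (\<lambda>(x, b). (x, \<not> b)) w)"

lemma inv_word_in_words: "w \<in> words X \<Longrightarrow> inv_word w \<in> words X"
  by (auto simp: inv_word_def)

lemma pres_eq_inv_word:
  assumes "w \<in> words X"
  shows "pres_eq X R (inv_word w @ w) []"
  using assms
proof (induction w)
  case Nil
  then show ?case by (simp add: inv_word_def pres_eq.refl)
next
  case (Cons a w)
  obtain x b where a: "a = (x, b)" by fastforce
  have w: "w \<in> words X" and x: "x \<in> X" using Cons.hyps a by auto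
  have 1: "pres_eq X R (([(x, \<not> b), (x, \<not> \<not> b)]) @ w) ([] @ w)"
    by (intro pres_eq.append pres_eq.cancel pres_eq.refl x w)
  have "pres_eq X R (inv_word w @ ([(x, \<not> b), (x, \<not> \<not> b)] @ w)) (inv_word w @ ([] @ w))"
    by (intro pres_eq.append[OF pres_eq.refl 1] inv_word_in_words w)
  moreover have "inv_word w @ ([(x, \<not> b), (x, \<not> \<not> b)] @ w) = inv_word (a # w) @ (a # w)"
    by (simp add: a inv_word_def)
  ultimately have "pres_eq X R (inv_word (a # w) @ (a # w)) (inv_word w @ w)"
    by (simp only: append_Nil)
  then show ?case using Cons.IH by (rule pres_eq.trans)
qed

lemma group_presented_group: "group (presented_group X R)"
proof (rule groupI)
  fix A B C
  assume "A \<in> carrier (presented_group X R)" "B \<in> carrier (presented_group X R)"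
    "C \<in> carrier (presented_group X R)"
  then obtain u v w where
    "u \<in> words X" "A = pres_class X R u" "v \<in> words X" "B = pres_class X R v"
    "w \<in> words X" "C = pres_class X R w"
    by (auto simp: presented_group_def)
  then show "A \<otimes>\<^bsub>presented_group X R\<^esub> B \<otimes>\<^bsub>presented_group X R\<^esub> C =
      A \<otimes>\<^bsub>presented_group X R\<^esub> (B \<otimes>\<^bsub>presented_group X R\<^esub> C)"
    by (simp add: presented_group_mult)
next
  fix A B
  assume "A \<in> carrier (presented_group X R)" "B \<in> carrier (presented_group X R)"
  then obtain u v where
    uv: "u \<in> words X" "A = pres_class X R u" "v \<in> words X" "B = pres_class X R v"
    by (auto simp: presented_group_def)
  then have "A \<otimes>\<^bsub>presented_group X R\<^esub> B = pres_class X R (u @ v)"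
    by (simp add: presented_group_mult)
  moreover have "u @ v \<in> words X" using uv by simp
  ultimately show "A \<otimes>\<^bsub>presented_group X R\<^esub> B \<in> carrier (presented_group X R)"
    by (simp add: presented_group_def)
next
  show "\<one>\<^bsub>presented_group X R\<^esub> \<in> carrier (presented_group X R)"
    by (simp add: presented_group_def)
next
  fix A
  assume "A \<in> carrier (presented_group X R)"
  then obtain u where u: "u \<in> words X" "A = pres_class X R u"
    by (auto simp: presented_group_def)
  have one: "\<one>\<^bsub>presented_group X R\<^esub> = pres_class X R []"
    by (simp add: presented_group_def)
  show "\<one>\<^bsub>presented_group X R\<^esub> \<otimes>\<^bsub>presented_group X R\<^esub> A = A"
    using presented_group_mult[of "[]" X u R] u one by simp
  have "pres_class X R (inv_word u) \<otimes>\<^bsub>presented_group X R\<^esub> A = \<one>\<^bsub>presented_group X R\<^esub>"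
    using u by (simp add: presented_group_mult inv_word_in_words one pres_class_eq_iff
        pres_eq_inv_word)
  moreover have "pres_class X R (inv_word u) \<in> carrier (presented_group X R)"
    using inv_word_in_words[OF u(1)] unfolding presented_group_def by simp
  ultimately show "\<exists>B\<in>carrier (presented_group X R).
      B \<otimes>\<^bsub>presented_group X R\<^esub> A = \<one>\<^bsub>presented_group X R\<^esub>"
    by blast
qed


subsection \<open>Coxeter systems and the alternating subgroup\<close>

definition coxeter_matrix :: "nat \<Rightarrow> (nat \<Rightarrow> nat \<Rightarrow> enat) \<Rightarrow> bool" where
  "coxeter_matrix n m \<longleftrightarrow>
    (\<forall>i<n. m i i = 1) \<and>
    (\<forall>i<n. \<forall>j<n. m i j = m j i) \<and>
    (\<forall>i<n. \<forall>j<n. i \<noteq> j \<longrightarrow> 2 \<le> m i j)"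

definition coxeter_rels :: "nat \<Rightarrow> (nat \<Rightarrow> nat \<Rightarrow> enat) \<Rightarrow> (nat word \<times> nat word) set" where
  "coxeter_rels n m =
    {(word_pow [(i, True), (j, True)] k, []) | i j k. i \<le> j \<and> j < n \<and> m i j = enat k}"

definition coxeter_group :: "nat \<Rightarrow> (nat \<Rightarrow> nat \<Rightarrow> enat) \<Rightarrow> nat word set monoid" where
  "coxeter_group n m = presented_group {..<n} (coxeter_rels n m)"

definition coxeter_gen :: "nat \<Rightarrow> (nat \<Rightarrow> nat \<Rightarrow> enat) \<Rightarrow> nat \<Rightarrow> nat word set" where
  "coxeter_gen n m i = pres_class {..<n} (coxeter_rels n m) [(i, True)]"

text \<open>Membership in \<^const>\<open>extensional\<close> fixes the value outside the carrier, so that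
  the description determines a unique HOL function (see \<open>coxeter_sign_ex1\<close> below).\<close>

definition coxeter_sign :: "nat \<Rightarrow> (nat \<Rightarrow> nat \<Rightarrow> enat) \<Rightarrow> nat word set \<Rightarrow> int" where
  "coxeter_sign n m =
    (THE \<epsilon>. \<epsilon> \<in> hom (coxeter_group n m) sign_img \<and>
         \<epsilon> \<in> extensional (carrier (coxeter_group n m)) \<and>
         (\<forall>i<n. \<epsilon> (coxeter_gen n m i) = -1))"

definition alternating_subgroup :: "nat \<Rightarrow> (nat \<Rightarrow> nat \<Rightarrow> enat) \<Rightarrow> nat word set set" where
  "alternating_subgroup n m = kernel (coxeter_group n m) sign_img (coxeter_sign n m)"

lemma even_length_word_pow: "even (length w) \<Longrightarrow> even (length (word_pow w k))"
  by (induction k) (auto simp: word_pow_def)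

lemma coxeter_parity:
  assumes "pres_eq {..<n} (coxeter_rels n m) u v"
  shows "even (length u) = even (length v)"
  using assms
proof induction
  case (rel u v)
  then show ?case by (auto simp: coxeter_rels_def intro!: even_length_word_pow)
qed auto

lemma coxeter_sign_ex1:
  "\<exists>!\<epsilon>. \<epsilon> \<in> hom (coxeter_group n m) sign_img \<and>
        \<epsilon> \<in> extensional (carrier (coxeter_group n m)) \<and>
        (\<forall>i<n. \<epsilon> (coxeter_gen n m i) = -1)"
proof -
  define X where "X = {..<n}"
  define R where "R = coxeter_rels n m"
  define cl where "cl = pres_class X R"
  define G where "G = presented_group X R"
  have G: "coxeter_group n m = G" by (simp add: coxeter_group_def G_def X_def R_def)
  have gen: "coxeter_gen n m i = cl [(i, True)]" for i
    by (simp add: coxeter_gen_def cl_def X_def R_def)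
  have carr: "carrier G = cl ` words X" by (simp add: G_def presented_group_def cl_def)
  have mult: "cl u \<otimes>\<^bsub>G\<^esub> cl v = cl (u @ v)" if "u \<in> words X" "v \<in> words X" for u v
    using that by (simp add: G_def cl_def presented_group_mult)
  interpret G: group G unfolding G_def by (rule group_presented_group)
  define s :: "nat word set \<Rightarrow> int" where
    "s = restrict (\<lambda>A. (-1) ^ length (SOME w. w \<in> A)) (carrier G)"
  have s_cl: "s (cl u) = (-1) ^ length u" if u: "u \<in> words X" for u
  proof -
    have "u \<in> cl u" using u by (simp add: cl_def pres_class_def pres_eq.refl)
    then have "(SOME w. w \<in> cl u) \<in> cl u" by (rule someI)
    then have "even (length u) = even (length (SOME w. w \<in> cl u))"
      using coxeter_parity[of n m u] by (simp add: cl_def pres_class_def X_def R_def)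
    then have "(-1::int) ^ length (SOME w. w \<in> cl u) = (-1) ^ length u"
      by (simp add: minus_one_power_iff)
    moreover have "cl u \<in> carrier G" using u by (simp add: carr)
    ultimately show ?thesis by (simp add: s_def)
  qed
  have "s \<in> hom G sign_img"
  proof (rule homI)
    fix A assume "A \<in> carrier G"
    then obtain u where "u \<in> words X" "A = cl u" by (auto simp: carr)
    then show "s A \<in> carrier sign_img"
      by (simp add: s_cl sign_img_def minus_one_power_iff)
  next
    fix A B assume "A \<in> carrier G" "B \<in> carrier G"
    then obtain u v where "u \<in> words X" "A = cl u" "v \<in> words X" "B = cl v"
      by (auto simp: carr)
    then show "s (A \<otimes>\<^bsub>G\<^esub> B) = s A \<otimes>\<^bsub>sign_img\<^esub> s B"
      by (simp add: mult s_cl sign_img_def power_add)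
  qed
  moreover have "s \<in> extensional (carrier G)" by (simp add: s_def)
  moreover have "\<forall>i<n. s (cl [(i, True)]) = -1" by (simp add: s_cl X_def)
  moreover have "e = s"
    if e: "e \<in> hom G sign_img" "e \<in> extensional (carrier G)" "\<forall>i<n. e (cl [(i, True)]) = -1"
    for e
  proof -
    have e_mult: "e (cl (u @ v)) = e (cl u) * e (cl v)" if "u \<in> words X" "v \<in> words X" for u v
      using hom_mult[OF e(1), of "cl u" "cl v"] that by (simp add: mult carr sign_img_def)
    have "e (cl []) * e (cl []) = e (cl [])" using e_mult[of "[]" "[]"] by simp
    moreover have "e (cl []) \<in> {-1, 1}"
      using hom_in_carrier[OF e(1), of "cl []"] by (simp add: carr sign_img_def)
    ultimately have e_Nil: "e (cl []) = 1" by auto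
    have e_letter: "e (cl [(i, b)]) = -1" if i: "i < n" for i b
    proof (cases b)
      case False
      have "pres_eq X R [(i, True), (i, \<not> True)] []"
        by (rule pres_eq.cancel) (simp add: X_def i)
      then have "cl ([(i, True)] @ [(i, False)]) = cl []"
        by (simp add: cl_def pres_class_eq_iff X_def i)
      then have "e (cl [(i, True)]) * e (cl [(i, False)]) = 1"
        using e_mult[of "[(i, True)]" "[(i, False)]"] e_Nil by (simp add: X_def i)
      then show ?thesis using e(3) i False by (simp add: minus_equation_iff)
    qed (use e(3) i in simp)
    have "e (cl u) = (-1) ^ length u" if "u \<in> words X" for u
      using that
    proof (induction u)
      case Nil
      then show ?case by (simp add: e_Nil)
    next
      case (Cons a u)
      obtain i b where a: "a = (i, b)" by fastforce
      then show ?case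
        using Cons e_mult[of "[a]" u] e_letter[of i b] by (simp add: X_def)
    qed
    then have "e A = s A" if "A \<in> carrier G" for A
      using that s_cl unfolding carr by (metis imageE)
    then show "e = s"
      using e(2) \<open>s \<in> extensional (carrier G)\<close> by (metis extensionalityI)
  qed
  ultimately show ?thesis unfolding G gen by blast
qed


subsection \<open>The Coxeter graph and its connected extensions\<close>

text \<open>A graph on the vertices \<open>{..<n}\<close> is represented by its set of edges \<open>{i, j}\<close>.\<close>

definition coxeter_edges :: "nat \<Rightarrow> (nat \<Rightarrow> nat \<Rightarrow> enat) \<Rightarrow> nat set set" where
  "coxeter_edges n m = {{i, j} | i j. i < n \<and> j < n \<and> i \<noteq> j \<and> 3 \<le> m i j}"

definition graph_components :: "nat \<Rightarrow> nat set set \<Rightarrow> nat set set" where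
  "graph_components n E = {..<n} // {(i, j). {i, j} \<in> E}\<^sup>*"

text \<open>\<open>Cs\<close> is a numbering of the components of the Coxeter graph, \<open>vs\<close> the list of chosen vertices.\<close>

definition connected_extension :: "nat \<Rightarrow> (nat \<Rightarrow> nat \<Rightarrow> enat) \<Rightarrow> nat set set \<Rightarrow> bool" where
  "connected_extension n m E \<longleftrightarrow>
    (\<exists>Cs vs. distinct Cs \<and> set Cs = graph_components n (coxeter_edges n m) \<and>
       length vs = length Cs \<and> (\<forall>a<length Cs. vs ! a \<in> Cs ! a) \<and>
       E = coxeter_edges n m \<union> {{vs ! l, vs ! Suc l} | l. Suc l < length vs})"


subsection \<open>The presentation of the alternating subgroup\<close>

definition alt_gens :: "nat set set \<Rightarrow> (nat \<times> nat) set" where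
  "alt_gens E = {(i, j). i < j \<and> {i, j} \<in> E}"

definition r_word :: "nat \<Rightarrow> nat \<Rightarrow> (nat \<times> nat) word" where
  "r_word i j = (if i < j then [((i, j), True)] else [((j, i), False)])"

fun walk_word :: "nat list \<Rightarrow> (nat \<times> nat) word" where
  "walk_word (i # j # vs) = r_word i j @ walk_word (j # vs)"
| "walk_word _ = []"

text \<open>The list \<open>[i, i\<^sub>1, \<dots>, i\<^sub>a]\<close> of pairwise distinct vertices represents the cycle
  with edges \<open>{i, i\<^sub>1}, {i\<^sub>1, i\<^sub>2}, \<dots>, {i\<^sub>a, i}\<close>.\<close>

definition graph_cycle :: "nat set set \<Rightarrow> nat list \<Rightarrow> bool" where
  "graph_cycle E vs \<longleftrightarrow>
    3 \<le> length vs \<and> distinct vs \<and> successively (\<lambda>i j. {i, j} \<in> E) (vs @ [hd vs])"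

definition not_connected :: "nat set set \<Rightarrow> nat \<times> nat \<Rightarrow> nat \<times> nat \<Rightarrow> bool" where
  "not_connected E = (\<lambda>(i, j) (k, l).
    {i, j} \<inter> {k, l} = {} \<and> (\<forall>a\<in>{i, j}. \<forall>b\<in>{k, l}. {a, b} \<notin> E))"

definition alt_rels ::
  "(nat \<Rightarrow> nat \<Rightarrow> enat) \<Rightarrow> nat set set \<Rightarrow> ((nat \<times> nat) word \<times> (nat \<times> nat) word) set" where
  "alt_rels m E =
    {(word_pow (r_word i j) k, []) | i j k. (i, j) \<in> alt_gens E \<and> m i j = enat k} \<union>
    {(walk_word (vs @ [hd vs]), []) | vs. graph_cycle E vs} \<union>
    {(word_pow (r_word i j @ r_word j k) 2, []) | i j k.
       {i, j} \<in> E \<and> {j, k} \<in> E \<and> i < k \<and> m i k = 2} \<union>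
    {(word_pow (r_word i j @ r_word j k @ r_word k l) 2, []) | i j k l.
       {i, j} \<in> E \<and> {j, k} \<in> E \<and> {k, l} \<in> E \<and> i < l \<and> m i l = 2} \<union>
    {(r_word i j @ r_word k l, r_word k l @ r_word i j) | i j k l.
       (i, j) \<in> alt_gens E \<and> (k, l) \<in> alt_gens E \<and> not_connected E (i, j) (k, l)}"

end

theory Submission
  imports Defs
begin

text \<open>
  Write \<open>W\<close> for the Coxeter group, \<open>W\<^sup>+\<close> for its alternating subgroup and \<open>P\<close> for the presented
  group. The isomorphism matches \<open>r\<^sub>i\<^sub>j\<close> with \<open>s\<^sub>i s\<^sub>j\<close>.

  The first observation is that \<open>W\<^sup>+\<close> is the universal group with elements \<open>R\<^sub>i\<^sub>j\<close>, one for each pair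
  of vertices, subject to \<open>R\<^sub>i\<^sub>j R\<^sub>j\<^sub>k = R\<^sub>i\<^sub>k\<close> and to \<open>R\<^sub>i\<^sub>j\<close> having order dividing \<open>m\<^sub>i\<^sub>j\<close> if this
  is finite. Given such elements in a group \<open>H\<close>, let \<open>W\<close> act from the right on two copies of \<open>H\<close>,
  thought of as \<open>H\<close> and \<open>H s\<^sub>0\<close>: since \<open>g s\<^sub>i = g (s\<^sub>i s\<^sub>0) s\<^sub>0\<close> and \<open>g s\<^sub>0 s\<^sub>i = g (s\<^sub>0 s\<^sub>i)\<close>, the generator \<open>s\<^sub>i\<close> multiplies by
  \<open>R\<^sub>i\<^sub>0\<close> on the way from the first copy to the second and by \<open>R\<^sub>0\<^sub>i\<close> on the way back. The Coxeter
  relations hold for this action (\<open>val_respects\<close>), and following the unit of the first copy under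
  \<open>W\<^sup>+\<close> gives a homomorphism \<open>W\<^sup>+ \<rightarrow> H\<close> sending \<open>s\<^sub>i s\<^sub>j\<close> to \<open>R\<^sub>i\<^sub>j\<close>.

  It remains to find these elements in \<open>P\<close>, where only the \<open>R\<^sub>i\<^sub>j\<close> along edges are given. As the graph
  is connected, \<open>R\<^sub>i\<^sub>j\<close> has to be the product of the generators along a walk from \<open>i\<close> to \<open>j\<close>. The
  cycle relations make every closed walk trivial (\<open>closed_walk_trivial\<close>), so the choice of the walk
  does not matter, and the multiplication rule is concatenation of walks. The order condition is a
  defining relation if \<open>{i, j}\<close> is an edge. Otherwise \<open>m\<^sub>i\<^sub>j = 2\<close>, and \<open>R\<^sub>i\<^sub>j\<^sup>2 = 1\<close> is shown along a
  chordless walk by induction on its length (\<open>R_square_chordless\<close>): for two or three steps this is a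
  defining relation, and for longer walks write \<open>R\<^sub>i\<^sub>j = a b c\<close> with \<open>a\<close> the first and \<open>c\<close> the last
  step. By induction \<open>b\<close>, \<open>a b\<close> and \<open>b c\<close> square to the identity, and \<open>a\<close> and \<open>c\<close> commute because their edges
  are not connected; these four facts give \<open>(a b c)\<^sup>2 = 1\<close>.

  In the other direction the relations of \<open>P\<close> hold for the \<open>s\<^sub>i s\<^sub>j\<close>, so von Dyck's theorem gives a
  homomorphism \<open>P \<rightarrow> W\<^sup>+\<close>. The two homomorphisms are inverse to each other on generators.

  The locale \<open>coxeter_graph\<close> abstracts from the construction of the connected extension: it asks for
  a connected graph without loops on the vertices \<open>{..<n}\<close> in which \<open>m\<^sub>i\<^sub>j = 2\<close> for all distinct
  non-adjacent \<open>i\<close> and \<open>j\<close>.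
\<close>

(* Membership of words is handled as membership in lists, not elementwise. *)
declare in_listsD [rule del] in_listsI [rule del]

section \<open>Evaluating words in a group\<close>

fun word_eval :: "('g, 'z) monoid_scheme \<Rightarrow> ('a \<Rightarrow> 'g) \<Rightarrow> 'a word \<Rightarrow> 'g" where
  "word_eval H f [] = \<one>\<^bsub>H\<^esub>"
| "word_eval H f ((x, b) # w) = (if b then f x else inv\<^bsub>H\<^esub> (f x)) \<otimes>\<^bsub>H\<^esub> word_eval H f w"

definition pres_lift :: "('g, 'z) monoid_scheme \<Rightarrow> ('a \<Rightarrow> 'g) \<Rightarrow> 'a word set \<Rightarrow> 'g" where
  "pres_lift H f A = the_elem (word_eval H f ` A)"

lemma word_pow_0 [simp]: "word_pow w 0 = []"
  by (simp add: word_pow_def)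

lemma word_pow_Suc [simp]: "word_pow w (Suc k) = w @ word_pow w k"
  by (simp add: word_pow_def)

lemma word_pow_in_words: "w \<in> words X \<Longrightarrow> word_pow w k \<in> words X"
  by (induction k) auto

lemma inv_word_append: "inv_word (u @ v) = inv_word v @ inv_word u"
  by (simp add: inv_word_def)

context group
begin

lemma word_eval_in_subgroup:
  assumes "subgroup K G" "\<And>x. x \<in> X \<Longrightarrow> f x \<in> K" "w \<in> words X"
  shows "word_eval G f w \<in> K"
  using assms(3)
  by (induction w)
    (auto simp: assms(2) subgroup.one_closed[OF assms(1)] subgroup.m_closed[OF assms(1)]
      subgroup.m_inv_closed[OF assms(1)])

lemmas word_eval_closed = word_eval_in_subgroup[OF subgroup_self]

lemma word_eval_append:
  assumes f: "\<And>x. x \<in> X \<Longrightarrow> f x \<in> carrier G" and "u \<in> words X" and v: "v \<in> words X"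
  shows "word_eval G f (u @ v) = word_eval G f u \<otimes> word_eval G f v"
  using assms(2)
  by (induction u) (auto simp: f word_eval_closed[of X f, OF f] v m_assoc)

lemma word_eval_word_pow:
  assumes f: "\<And>x. x \<in> X \<Longrightarrow> f x \<in> carrier G" and w: "w \<in> words X"
  shows "word_eval G f (word_pow w k) = word_eval G f w [^] k"
proof (induction k)
  case (Suc k)
  have "word_eval G f (word_pow w (Suc k)) = word_eval G f w \<otimes> word_eval G f w [^] k"
    using Suc word_eval_append[OF f w word_pow_in_words[OF w]] by simp
  then show ?case
    using nat_pow_Suc2[OF word_eval_closed[of X f w, OF f w]] by simp
qed simp

lemma word_eval_respects:
  assumes f: "\<And>x. x \<in> X \<Longrightarrow> f x \<in> carrier G"
    and rels: "\<And>u v. \<lbrakk>(u, v) \<in> R; u \<in> words X; v \<in> words X\<rbrakk> \<Longrightarrow> word_eval G f u = word_eval G f v"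
    and "pres_eq X R u v"
  shows "word_eval G f u = word_eval G f v"
  using assms(3)
proof induction
  case (append u u' v v')
  then show ?case
    using pres_eq_words[OF append.hyps(1)] pres_eq_words[OF append.hyps(2)]
    by (simp only: word_eval_append[OF f])
qed (auto simp: f rels)

text \<open>Von Dyck's theorem.\<close>

lemma
  assumes f: "\<And>x. x \<in> X \<Longrightarrow> f x \<in> carrier G"
    and rels: "\<And>u v. \<lbrakk>(u, v) \<in> R; u \<in> words X; v \<in> words X\<rbrakk> \<Longrightarrow> word_eval G f u = word_eval G f v"
  shows pres_lift_class: "u \<in> words X \<Longrightarrow> pres_lift G f (pres_class X R u) = word_eval G f u"
    and pres_lift_hom: "pres_lift G f \<in> hom (presented_group X R) G"
proof -
  show lift: "pres_lift G f (pres_class X R u) = word_eval G f u" if "u \<in> words X" for u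
  proof -
    have "word_eval G f ` pres_class X R u = {word_eval G f u}"
      using word_eval_respects[OF f rels] that by (auto simp: pres_class_def intro: pres_eq.refl)
    then show ?thesis by (simp add: pres_lift_def)
  qed
  show "pres_lift G f \<in> hom (presented_group X R) G"
  proof (rule homI)
    fix A assume "A \<in> carrier (presented_group X R)"
    then show "pres_lift G f A \<in> carrier G"
      using lift word_eval_closed[of X f, OF f] by (auto simp: presented_group_def)
  next
    fix A B assume "A \<in> carrier (presented_group X R)" "B \<in> carrier (presented_group X R)"
    then obtain u v where uv: "u \<in> words X" "A = pres_class X R u"
        "v \<in> words X" "B = pres_class X R v"
      by (auto simp: presented_group_def)
    then have "u @ v \<in> words X" by simp
    from lift[OF this] show
      "pres_lift G f (A \<otimes>\<^bsub>presented_group X R\<^esub> B) = pres_lift G f A \<otimes> pres_lift G f B"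
      using lift[OF uv(1)] lift[OF uv(3)] word_eval_append[OF f uv(1) uv(3)]
      by (simp only: uv(2,4) presented_group_mult[OF uv(1,3)])
  qed
qed

lemma mult_commutes:
  assumes "x \<otimes> z = z \<otimes> x" "y \<otimes> z = z \<otimes> y"
    and [simp]: "x \<in> carrier G" "y \<in> carrier G" "z \<in> carrier G"
  shows "(x \<otimes> y) \<otimes> z = z \<otimes> (x \<otimes> y)"
proof -
  have "(x \<otimes> y) \<otimes> z = x \<otimes> z \<otimes> y" by (simp add: m_assoc assms(2))
  also have "\<dots> = z \<otimes> (x \<otimes> y)" by (simp add: m_assoc assms(1))
  finally show ?thesis .
qed

text \<open>The induction step for walks of at least four steps: \<open>c b c = b\<close> follows from \<open>b\<^sup>2 = (b c)\<^sup>2 = 1\<close>,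
  and moving \<open>c\<close> past \<open>a\<close> turns the square into \<open>a b a (c b c) = (a b)\<^sup>2\<close>.\<close>

lemma square_of_triple_product:
  assumes [simp]: "a \<in> carrier G" "b \<in> carrier G" "c \<in> carrier G"
    and b: "b [^] (2::nat) = \<one>" and ab: "(a \<otimes> b) [^] (2::nat) = \<one>"
    and bc: "(b \<otimes> c) [^] (2::nat) = \<one>" and ac: "a \<otimes> c = c \<otimes> a"
  shows "(a \<otimes> b \<otimes> c) [^] (2::nat) = \<one>"
proof -
  have sq: "x [^] (2::nat) = x \<otimes> x" if "x \<in> carrier G" for x
    using that by (simp add: numeral_2_eq_2)
  have "b \<otimes> (c \<otimes> b \<otimes> c) = b \<otimes> b"
    using b bc by (simp add: sq m_assoc)
  then have cbc: "c \<otimes> b \<otimes> c = b" by simp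
  have "(a \<otimes> b \<otimes> c) [^] (2::nat) = a \<otimes> b \<otimes> (c \<otimes> a) \<otimes> b \<otimes> c"
    by (simp add: sq m_assoc)
  also have "\<dots> = a \<otimes> b \<otimes> a \<otimes> (c \<otimes> b \<otimes> c)"
    by (simp add: ac[symmetric] m_assoc)
  also have "\<dots> = \<one>"
    using ab by (simp add: cbc sq m_assoc)
  finally show ?thesis .
qed

end

lemma presented_group_class_closed:
  "u \<in> words X \<Longrightarrow> pres_class X R u \<in> carrier (presented_group X R)"
  by (simp add: presented_group_def)

lemma presented_group_one: "\<one>\<^bsub>presented_group X R\<^esub> = pres_class X R []"
  by (simp add: presented_group_def)

lemma pres_class_inv_word:
  assumes "u \<in> words X"
  shows "pres_class X R (inv_word u) = inv\<^bsub>presented_group X R\<^esub> (pres_class X R u)"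
proof -
  interpret group "presented_group X R" by (rule group_presented_group)
  have w: "inv_word u \<in> words X" by (rule inv_word_in_words[OF assms])
  have "pres_class X R (inv_word u) \<otimes>\<^bsub>presented_group X R\<^esub> pres_class X R u =
      \<one>\<^bsub>presented_group X R\<^esub>"
    using pres_eq_inv_word[OF assms, of R] assms w
    by (simp add: presented_group_mult presented_group_one pres_class_eq_iff)
  from inv_equality[OF this] show ?thesis
    using assms w by (simp add: presented_group_class_closed)
qed

lemma pres_class_word_pow:
  assumes w: "w \<in> words X"
  shows "pres_class X R (word_pow w k) = pres_class X R w [^]\<^bsub>presented_group X R\<^esub> k"
proof -
  interpret group "presented_group X R" by (rule group_presented_group)
  show ?thesis
  proof (induction k)
    case 0
    show ?case by (simp add: presented_group_one)
  next
    case (Suc k)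
    then show ?case
      using presented_group_mult[OF w word_pow_in_words[OF w, of k], of R]
        nat_pow_Suc2[OF presented_group_class_closed[OF w], of k] by simp
  qed
qed

lemma presented_group_hom_fixing_generators:
  assumes h: "h \<in> hom (presented_group X R) (presented_group X R)"
    and gens: "\<And>x. x \<in> X \<Longrightarrow> h (pres_class X R [(x, True)]) = pres_class X R [(x, True)]"
    and A: "A \<in> carrier (presented_group X R)"
  shows "h A = A"
proof -
  let ?P = "presented_group X R"
  interpret P: group ?P by (rule group_presented_group)
  interpret h: group_hom ?P ?P h
    using h by (simp add: group_hom_def group_hom_axioms_def P.group_axioms)
  have "h (pres_class X R u) = pres_class X R u" if "u \<in> words X" for u
    using that
  proof (induction u)
    case Nil
    then show ?case using h.hom_one by (simp add: presented_group_one)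
  next
    case (Cons a u)
    obtain x b where a: "a = (x, b)" by fastforce
    with Cons have x: "[(x, b)] \<in> words X" "[(x, True)] \<in> words X" and u: "u \<in> words X" by auto
    have "h (pres_class X R [(x, b)]) = pres_class X R [(x, b)]"
    proof (cases b)
      case False
      have "[(x, b)] = inv_word [(x, True)]" using False by (simp add: inv_word_def)
      then show ?thesis
        using x gens[of x] by (simp add: pres_class_inv_word h.hom_inv presented_group_class_closed)
    qed (use gens x in simp)
    moreover have "pres_class X R (a # u) = pres_class X R [(x, b)] \<otimes>\<^bsub>?P\<^esub> pres_class X R u"
      using presented_group_mult[OF x(1) u, of R] a by simp
    ultimately show ?case
      using Cons x u by (simp add: h.hom_mult presented_group_class_closed)
  qed
  then show ?thesis using A by (auto simp: presented_group_def)
qed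


section \<open>The alternating subgroup of a Coxeter group\<close>

locale coxeter =
  fixes n :: nat and m :: "nat \<Rightarrow> nat \<Rightarrow> enat"
  assumes coxeter_matrix: "coxeter_matrix n m"
begin

abbreviation "W \<equiv> coxeter_group n m"
abbreviation "s \<equiv> coxeter_gen n m"
abbreviation "cox_class \<equiv> pres_class {..<n} (coxeter_rels n m)"
abbreviation "Alt \<equiv> alternating_subgroup n m"

sublocale W: group W
  unfolding coxeter_group_def by (rule group_presented_group)

lemma m_diag: "i < n \<Longrightarrow> m i i = 1"
  and m_sym: "\<lbrakk>i < n; j < n\<rbrakk> \<Longrightarrow> m i j = m j i"
  and m_ge2: "\<lbrakk>i < n; j < n; i \<noteq> j\<rbrakk> \<Longrightarrow> 2 \<le> m i j"
  using coxeter_matrix unfolding coxeter_matrix_def by blast+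

lemma s_closed [simp]: "i < n \<Longrightarrow> s i \<in> carrier W"
  by (simp add: coxeter_gen_def coxeter_group_def presented_group_class_closed)

lemma cox_class_append:
  "\<lbrakk>u \<in> words {..<n}; v \<in> words {..<n}\<rbrakk> \<Longrightarrow> cox_class (u @ v) = cox_class u \<otimes>\<^bsub>W\<^esub> cox_class v"
  by (simp add: coxeter_group_def presented_group_mult)

lemma s_pow:
  assumes "i \<le> j" "j < n" "m i j = enat k"
  shows "(s i \<otimes>\<^bsub>W\<^esub> s j) [^]\<^bsub>W\<^esub> k = \<one>\<^bsub>W\<^esub>"
proof -
  let ?w = "[(i, True), (j, True)]"
  have w: "?w \<in> words {..<n}" using assms by simp
  have "(word_pow ?w k, []) \<in> coxeter_rels n m"
    using assms unfolding coxeter_rels_def by blast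
  then have "pres_eq {..<n} (coxeter_rels n m) (word_pow ?w k) []"
    by (rule pres_eq.rel) (simp_all add: word_pow_in_words[OF w])
  then have "cox_class (word_pow ?w k) = \<one>\<^bsub>W\<^esub>"
    by (simp add: pres_class_eq_iff word_pow_in_words[OF w] coxeter_group_def presented_group_one)
  moreover have "cox_class ?w = s i \<otimes>\<^bsub>W\<^esub> s j"
    using cox_class_append[of "[(i, True)]" "[(j, True)]"] assms by (simp add: coxeter_gen_def)
  ultimately show ?thesis
    using pres_class_word_pow[OF w] by (simp add: coxeter_group_def)
qed

lemma s_square [simp]: "i < n \<Longrightarrow> s i \<otimes>\<^bsub>W\<^esub> s i = \<one>\<^bsub>W\<^esub>"
  using s_pow[of i i 1] m_diag[of i] by (simp add: one_enat_def)

lemma s_inv: "i < n \<Longrightarrow> inv\<^bsub>W\<^esub> (s i) = s i"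
  by (simp add: W.inv_equality)

lemma s_commute:
  assumes "i < n" "j < n" "m i j = 2"
  shows "s i \<otimes>\<^bsub>W\<^esub> s j = s j \<otimes>\<^bsub>W\<^esub> s i"
proof -
  have *: "s i \<otimes>\<^bsub>W\<^esub> s j = s j \<otimes>\<^bsub>W\<^esub> s i" if "i < n" "j < n" "m i j = 2" "i \<le> j" for i j
  proof -
    have "(s i \<otimes>\<^bsub>W\<^esub> s j) \<otimes>\<^bsub>W\<^esub> (s i \<otimes>\<^bsub>W\<^esub> s j) = \<one>\<^bsub>W\<^esub>"
      using s_pow[of i j 2] that by (simp add: numeral_2_eq_2 eSuc_enat[symmetric] numeral_eq_enat)
    then have "inv\<^bsub>W\<^esub> (s i \<otimes>\<^bsub>W\<^esub> s j) = s i \<otimes>\<^bsub>W\<^esub> s j"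
      using that by (intro W.inv_equality) auto
    then show ?thesis using that by (simp add: W.inv_mult_group s_inv)
  qed
  show ?thesis
    using *[of i j] *[of j i] assms m_sym[of i j] by (metis linorder_le_cases)
qed

lemma cox_class_letter:
  assumes "i < n" shows "cox_class [(i, b)] = s i"
proof (cases b)
  case False
  have "[(i, b)] = inv_word [(i, True)]" using False by (simp add: inv_word_def)
  then have "cox_class [(i, b)] = inv\<^bsub>W\<^esub> (s i)"
    using pres_class_inv_word[of "[(i, True)]" "{..<n}" "coxeter_rels n m"] assms
    by (simp add: coxeter_gen_def coxeter_group_def)
  then show ?thesis using assms by (simp add: s_inv)
qed (simp add: coxeter_gen_def)

lemma cox_class_Cons:
  assumes "i < n" "w \<in> words {..<n}"
  shows "cox_class ((i, b) # w) = s i \<otimes>\<^bsub>W\<^esub> cox_class w"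
  using cox_class_append[of "[(i, b)]" w] assms by (simp add: cox_class_letter)

lemma cox_class_Nil: "cox_class [] = \<one>\<^bsub>W\<^esub>"
  by (simp add: coxeter_group_def presented_group_one)

lemma cox_class_closed: "w \<in> words {..<n} \<Longrightarrow> cox_class w \<in> carrier W"
  by (simp add: coxeter_group_def presented_group_class_closed)

lemma carrier_W: "carrier W = cox_class ` words {..<n}"
  by (simp add: coxeter_group_def presented_group_def)

lemma coxeter_sign_hom: "coxeter_sign n m \<in> hom W sign_img"
  and coxeter_sign_gen: "i < n \<Longrightarrow> coxeter_sign n m (s i) = -1"
  using theI'[OF coxeter_sign_ex1[of n m]] unfolding coxeter_sign_def[symmetric] by blast+

lemma sign_hom: "group_hom W sign_img (coxeter_sign n m)"
  using coxeter_sign_hom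
  by (simp add: group_hom_def group_hom_axioms_def W.group_axioms sign_img_is_group)

lemma subgroup_Alt: "subgroup Alt W"
  unfolding alternating_subgroup_def by (rule group_hom.subgroup_kernel[OF sign_hom])

lemma coxeter_sign_class:
  assumes "u \<in> words {..<n}"
  shows "coxeter_sign n m (cox_class u) = (-1) ^ length u"
  using assms
proof (induction u)
  case Nil
  show ?case using group_hom.hom_one[OF sign_hom] by (simp add: cox_class_Nil sign_img_def)
next
  case (Cons a u)
  obtain i b where a: "a = (i, b)" by fastforce
  then have i: "i < n" and u: "u \<in> words {..<n}" using Cons by auto
  have "coxeter_sign n m (s i \<otimes>\<^bsub>W\<^esub> cox_class u) =
      coxeter_sign n m (s i) * coxeter_sign n m (cox_class u)"
    using hom_mult[OF coxeter_sign_hom s_closed[OF i] cox_class_closed[OF u]]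
    by (simp add: sign_img_def)
  then show ?case
    using Cons.IH i u by (simp add: a cox_class_Cons coxeter_sign_gen)
qed

lemma cox_class_in_Alt_iff:
  "u \<in> words {..<n} \<Longrightarrow> cox_class u \<in> Alt \<longleftrightarrow> even (length u)"
  by (simp add: alternating_subgroup_def kernel_def cox_class_closed coxeter_sign_class
      sign_img_def minus_one_power_iff)

lemma Alt_eq: "Alt = cox_class ` {u \<in> words {..<n}. even (length u)}"
proof -
  have "Alt \<subseteq> carrier W" using subgroup_Alt by (rule subgroup.subset)
  then show ?thesis by (auto simp: carrier_W cox_class_in_Alt_iff)
qed

lemma s_s_in_Alt: "\<lbrakk>i < n; j < n\<rbrakk> \<Longrightarrow> s i \<otimes>\<^bsub>W\<^esub> s j \<in> Alt"
  using cox_class_in_Alt_iff[of "[(i, True), (j, True)]"] cox_class_append[of "[(i, True)]" "[(j, True)]"]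
  by (simp add: coxeter_gen_def)

text \<open>The products \<open>s\<^sub>i s\<^sub>j\<close> generate: words of even length split into pairs of letters, and inverse
  letters may be ignored because the \<open>s\<^sub>i\<close> are involutions.\<close>

lemma Alt_induct [consumes 1, case_names one mult]:
  assumes "A \<in> Alt" and one: "Q \<one>\<^bsub>W\<^esub>"
    and mult: "\<And>i j B. \<lbrakk>i < n; j < n; B \<in> Alt; Q B\<rbrakk> \<Longrightarrow> Q (s i \<otimes>\<^bsub>W\<^esub> s j \<otimes>\<^bsub>W\<^esub> B)"
  shows "Q A"
proof -
  have "Q (cox_class u)" if "u \<in> words {..<n}" "even (length u)" for u
    using that
  proof (induction u rule: induct_list012)
    case 1
    then show ?case by (simp add: one cox_class_Nil)
  next
    case (3 x y w)
    obtain i b j c where xy: "x = (i, b)" "y = (j, c)" by fastforce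
    have ij: "i < n" "j < n" and w: "w \<in> words {..<n}" "even (length w)" using 3 xy by auto
    have "cox_class w \<in> Alt" using w cox_class_in_Alt_iff by simp
    from mult[OF ij this 3(1)[OF w]] show ?case
      using xy ij w by (simp add: cox_class_Cons W.m_assoc cox_class_closed)
  qed simp
  then show ?thesis using \<open>A \<in> Alt\<close> by (auto simp: Alt_eq)
qed

end

section \<open>The universal property of the alternating subgroup\<close>

text \<open>The action of \<open>W\<close> on \<open>H\<close> and \<open>H s\<^sub>0\<close>: starting in the copy \<open>H\<close> (\<open>True\<close>) or \<open>H s\<^sub>0\<close> (\<open>False\<close>), a word
  multiplies the \<open>H\<close>-component from the right by this value. A letter and its formal inverse act
  alike, as they should for involutions.\<close>

fun coset_val :: "('g, 'z) monoid_scheme \<Rightarrow> (nat \<Rightarrow> nat \<Rightarrow> 'g) \<Rightarrow> bool \<Rightarrow> nat word \<Rightarrow> 'g" where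
  "coset_val H R b [] = \<one>\<^bsub>H\<^esub>"
| "coset_val H R b ((i, c) # w) = (if b then R i 0 else R 0 i) \<otimes>\<^bsub>H\<^esub> coset_val H R (\<not> b) w"

text \<open>The products \<open>s\<^sub>i s\<^sub>j\<close> satisfy these conditions in \<open>W\<^sup>+\<close>; \<open>alt_lift\<close> below shows that they
  are the universal solution.\<close>

locale coxeter_cocycle = coxeter n m + H: group H
  for n m and H :: "('g, 'z) monoid_scheme" (structure) +
  fixes R :: "nat \<Rightarrow> nat \<Rightarrow> 'g"
  assumes R_closed [simp]: "\<lbrakk>i < n; j < n\<rbrakk> \<Longrightarrow> R i j \<in> carrier H"
    and R_mult: "\<lbrakk>i < n; j < n; k < n\<rbrakk> \<Longrightarrow> R i j \<otimes> R j k = R i k"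
    and R_pow: "\<lbrakk>i < n; j < n; m i j = enat k\<rbrakk> \<Longrightarrow> R i j [^] k = \<one>"
begin

lemma R_diag: "i < n \<Longrightarrow> R i i = \<one>"
  using R_mult[of i i i] by (simp add: H.l_cancel_one)

abbreviation "val \<equiv> coset_val H R"

lemma val_closed [simp]: "w \<in> words {..<n} \<Longrightarrow> val b w \<in> carrier H"
proof (induction w arbitrary: b)
  case (Cons a w)
  obtain i c where a: "a = (i, c)" by fastforce
  then have "i < n" "0 < n" using Cons by auto
  then show ?case using Cons a by simp
qed simp

lemma val_append:
  assumes "u \<in> words {..<n}" and v: "v \<in> words {..<n}"
  shows "val b (u @ v) = val b u \<otimes> val (b = even (length u)) v"
  using assms(1)
proof (induction u arbitrary: b)
  case (Cons a u)
  obtain i c where a: "a = (i, c)" by fastforce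
  then have i: "i < n" "0 < n" using Cons by auto
  have "((\<not> b) = even (length u)) = (b = even (length (a # u)))" by auto
  then show ?case using Cons a i v by (simp add: H.m_assoc)
qed (use v in simp)

lemma val_word_pow:
  assumes w: "w \<in> words {..<n}" and "even (length w)"
  shows "val b (word_pow w k) = val b w [^] k"
proof (induction k)
  case (Suc k)
  then show ?case
    using assms val_append[OF w word_pow_in_words[OF w, of k], of b] H.nat_pow_Suc2[of "val b w" k]
    by simp
qed simp

text \<open>On the copy \<open>H s\<^sub>0\<close> the word \<open>s\<^sub>i s\<^sub>j\<close> acts by \<open>R\<^sub>0\<^sub>i R\<^sub>j\<^sub>0\<close>, which is \<open>R\<^sub>j\<^sub>i\<close> conjugated by
  \<open>R\<^sub>0\<^sub>i\<close> and so satisfies the same power relations.\<close>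

lemma base_conj_pow:
  assumes i: "i < n" "j < n" "b < n"
  shows "(R b i \<otimes> R j b) [^] k = R b i \<otimes> R j i [^] (k::nat) \<otimes> R i b"
proof (induction k)
  case 0
  show ?case using i by (simp add: R_mult R_diag)
next
  case (Suc k)
  have "(R b i \<otimes> R j b) [^] Suc k = R b i \<otimes> R j i [^] k \<otimes> (R i b \<otimes> R b i) \<otimes> R j b"
    using Suc i by (simp add: H.m_assoc)
  also have "\<dots> = R b i \<otimes> R j i [^] k \<otimes> (R j i \<otimes> R i b)"
    using i by (simp add: R_mult R_diag)
  finally show ?case using i by (simp add: H.m_assoc)
qed

text \<open>Both starting copies have to be treated at once: a prefix of odd length moves the rest of the
  word to the other copy.\<close>

lemma val_respects:
  assumes "pres_eq {..<n} (coxeter_rels n m) u v"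
  shows "val b u = val b v"
  using assms
proof (induction arbitrary: b)
  case (append u u' v v')
  have "even (length u) = even (length u')" by (rule coxeter_parity[OF append.hyps(1)])
  then show ?case
    using pres_eq_words[OF append.hyps(1)] pres_eq_words[OF append.hyps(2)]
    by (simp only: val_append append.IH)
next
  case (cancel i c)
  then have "i < n" "0 < n" by auto
  then show ?case by (simp add: R_mult R_diag)
next
  case (rel u v)
  then obtain i j k where u: "u = word_pow [(i, True), (j, True)] k" and v: "v = []"
    and ij: "i \<le> j" "j < n" and mk: "m i j = enat k"
    unfolding coxeter_rels_def by blast
  have i: "i < n" "0 < n" using ij by auto
  have "val True u = (R i 0 \<otimes> R 0 j) [^] k" and "val False u = (R 0 i \<otimes> R j 0) [^] k"
    using i ij by (simp_all add: u val_word_pow)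
  moreover have "(R i 0 \<otimes> R 0 j) [^] k = \<one>"
    using i ij R_pow[OF _ _ mk] by (simp add: R_mult)
  moreover have "(R 0 i \<otimes> R j 0) [^] k = \<one>"
    using i ij mk m_sym[of i j] R_pow[of j i k] by (simp add: base_conj_pow R_mult R_diag)
  ultimately show ?case using v by (cases b) auto
qed auto

definition alt_lift :: "nat word set \<Rightarrow> 'g" where
  "alt_lift A = the_elem (val True ` A)"

lemma alt_lift_class:
  assumes "u \<in> words {..<n}"
  shows "alt_lift (cox_class u) = val True u"
proof -
  have "val True ` cox_class u = {val True u}"
    using val_respects assms by (auto simp: pres_class_def intro: pres_eq.refl)
  then show ?thesis by (simp add: alt_lift_def)
qed

lemma alt_lift_hom: "alt_lift \<in> hom (W\<lparr>carrier := Alt\<rparr>) H"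
proof (rule homI)
  fix A assume "A \<in> carrier (W\<lparr>carrier := Alt\<rparr>)"
  then show "alt_lift A \<in> carrier H" by (auto simp: Alt_eq alt_lift_class)
next
  fix A B assume "A \<in> carrier (W\<lparr>carrier := Alt\<rparr>)" "B \<in> carrier (W\<lparr>carrier := Alt\<rparr>)"
  then obtain u v where uv: "u \<in> words {..<n}" "even (length u)" "A = cox_class u"
      "v \<in> words {..<n}" "B = cox_class v"
    by (auto simp: Alt_eq)
  then have "u @ v \<in> words {..<n}" by simp
  then have "alt_lift (cox_class (u @ v)) = alt_lift A \<otimes> alt_lift B"
    using uv by (simp only: alt_lift_class) (simp add: val_append)
  then show "alt_lift (A \<otimes>\<^bsub>W\<lparr>carrier := Alt\<rparr>\<^esub> B) = alt_lift A \<otimes> alt_lift B"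
    using uv by (simp add: cox_class_append)
qed

lemma alt_lift_gen:
  assumes "i < n" "j < n"
  shows "alt_lift (s i \<otimes>\<^bsub>W\<^esub> s j) = R i j"
proof -
  have "cox_class [(i, True), (j, True)] = s i \<otimes>\<^bsub>W\<^esub> s j"
    using assms cox_class_append[of "[(i, True)]" "[(j, True)]"] by (simp add: coxeter_gen_def)
  moreover have "0 < n" using assms by simp
  ultimately show ?thesis
    using alt_lift_class[of "[(i, True), (j, True)]"] assms by (simp add: R_mult)
qed

end


section \<open>Walks in a graph\<close>

definition walk_between :: "nat set set \<Rightarrow> nat \<Rightarrow> nat \<Rightarrow> nat list \<Rightarrow> bool" where
  "walk_between E i j xs \<longleftrightarrow>
    xs \<noteq> [] \<and> hd xs = i \<and> last xs = j \<and> successively (\<lambda>i j. {i, j} \<in> E) xs"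

text \<open>For walks without loops these are the induced paths; \<open>bs \<noteq> []\<close> exempts consecutive vertices.\<close>

definition chordless :: "nat set set \<Rightarrow> nat list \<Rightarrow> bool" where
  "chordless E xs \<longleftrightarrow>
    (\<forall>as x bs y cs. xs = as @ x # bs @ y # cs \<and> bs \<noteq> [] \<longrightarrow> x \<noteq> y \<and> {x, y} \<notin> E)"

lemma walk_word_append:
  "walk_word (xs @ [y] @ ys) = walk_word (xs @ [y]) @ walk_word (y # ys)"
proof (induction xs)
  case (Cons x xs)
  then show ?case by (cases xs) auto
qed simp

lemma r_word_swap: "i \<noteq> j \<Longrightarrow> r_word j i = inv_word (r_word i j)"
  by (simp add: r_word_def inv_word_def)

lemma walk_word_rev:
  "successively (\<noteq>) xs \<Longrightarrow> walk_word (rev xs) = inv_word (walk_word xs)"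
proof (induction xs rule: walk_word.induct)
  case (1 i j vs)
  then show ?case
    using walk_word_append[of "rev vs" j "[i]"] r_word_swap[of i j] by (simp add: inv_word_append)
qed (simp_all add: inv_word_def)

lemma walk_exists:
  assumes "(i, j) \<in> {(i, j). {i, j} \<in> E}\<^sup>*"
  shows "\<exists>xs. walk_between E i j xs"
  using assms
proof (induction rule: converse_rtrancl_induct)
  case base
  have "walk_between E j j [j]" by (simp add: walk_between_def)
  then show ?case ..
next
  case (step i k)
  then obtain xs where "walk_between E k j xs" by blast
  then have "walk_between E i j (i # xs)"
    using step.hyps(1) by (auto simp: walk_between_def successively_Cons)
  then show ?case ..
qed

text \<open>A chord or a repeated vertex yields a shorter walk, so a shortest walk is chordless.\<close>

lemma chordless_walk_exists:
  assumes "walk_between E i j ws"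
  shows "\<exists>xs. walk_between E i j xs \<and> chordless E xs"
proof -
  obtain xs where xs: "walk_between E i j xs"
    and min: "\<And>ys. walk_between E i j ys \<Longrightarrow> length xs \<le> length ys"
    using exists_least_iff[of "\<lambda>k. \<exists>ys. walk_between E i j ys \<and> length ys = k"] assms
    by (metis linorder_not_less)
  have "x \<noteq> y \<and> {x, y} \<notin> E" if eq: "xs = as @ x # bs @ y # cs" and "bs \<noteq> []" for as x bs y cs
  proof (intro conjI notI)
    assume "x = y"
    then have "walk_between E i j (as @ x # cs)"
      using xs eq by (auto simp: walk_between_def successively_append_iff successively_Cons hd_append)
    from min[OF this] show False using eq by simp
  next
    assume "{x, y} \<in> E"
    then have "walk_between E i j (as @ x # y # cs)"
      using xs eq by (auto simp: walk_between_def successively_append_iff successively_Cons hd_append)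
    from min[OF this] show False using eq \<open>bs \<noteq> []\<close> by simp
  qed
  then have "chordless E xs" unfolding chordless_def by blast
  with xs show ?thesis by blast
qed

lemma chordless_infix:
  assumes "chordless E (us @ xs @ vs)"
  shows "chordless E xs"
  unfolding chordless_def
proof (intro allI impI)
  fix as x bs y cs
  assume "xs = as @ x # bs @ y # cs \<and> bs \<noteq> []"
  then have "us @ xs @ vs = (us @ as) @ x # bs @ y # (cs @ vs) \<and> bs \<noteq> []" by simp
  then show "x \<noteq> y \<and> {x, y} \<notin> E" using assms unfolding chordless_def by blast
qed


section \<open>The presented group\<close>

locale coxeter_graph = coxeter n m for n m +
  fixes E :: "nat set set"
  assumes edge_less: "{i, j} \<in> E \<Longrightarrow> i < n"
    and edge_neq: "{i, j} \<in> E \<Longrightarrow> i \<noteq> j"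
    and non_edge: "\<lbrakk>i < n; j < n; i \<noteq> j; {i, j} \<notin> E\<rbrakk> \<Longrightarrow> m i j = 2"
    and connected: "\<lbrakk>i < n; j < n\<rbrakk> \<Longrightarrow> (i, j) \<in> {(i, j). {i, j} \<in> E}\<^sup>*"
begin

abbreviation "P \<equiv> presented_group (alt_gens E) (alt_rels m E)"
abbreviation "rcl \<equiv> pres_class (alt_gens E) (alt_rels m E)"

sublocale P: group P by (rule group_presented_group)

lemma edge_less2: "{i, j} \<in> E \<Longrightarrow> j < n"
  using edge_less[of j i] by (simp add: insert_commute)

lemma edgeD: "{i, j} \<in> E \<Longrightarrow> i < n \<and> j < n \<and> i \<noteq> j"
  using edge_less edge_less2 edge_neq by simp

lemma r_word_in_words: "{i, j} \<in> E \<Longrightarrow> r_word i j \<in> words (alt_gens E)"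
  using edge_neq[of i j] by (auto simp: r_word_def alt_gens_def insert_commute)

lemma walk_word_in_words:
  "successively (\<lambda>i j. {i, j} \<in> E) xs \<Longrightarrow> walk_word xs \<in> words (alt_gens E)"
  by (induction xs rule: walk_word.induct) (auto simp: r_word_in_words)

lemma rcl_append:
  "\<lbrakk>u \<in> words (alt_gens E); v \<in> words (alt_gens E)\<rbrakk> \<Longrightarrow> rcl (u @ v) = rcl u \<otimes>\<^bsub>P\<^esub> rcl v"
  by (simp add: presented_group_mult)

lemma rcl_closed: "u \<in> words (alt_gens E) \<Longrightarrow> rcl u \<in> carrier P"
  by (rule presented_group_class_closed)

lemma rcl_rel:
  assumes "(u, v) \<in> alt_rels m E" "u \<in> words (alt_gens E)" "v \<in> words (alt_gens E)"
  shows "rcl u = rcl v"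
  using pres_eq.rel[OF assms] assms(2) by (simp add: pres_class_eq_iff)

lemma rcl_Nil: "rcl [] = \<one>\<^bsub>P\<^esub>"
  by (simp add: presented_group_one)

text \<open>A closed walk that repeats a vertex \<open>y\<close> before its end splits at \<open>y\<close> into two shorter closed
  walks. Without such a repetition it is a single vertex, a step back and forth, or a cycle of the graph.\<close>

lemma closed_walk_trivial:
  assumes "walk_between E i i zs"
  shows "rcl (walk_word zs) = \<one>\<^bsub>P\<^esub>"
  using assms
proof (induction "length zs" arbitrary: i zs rule: less_induct)
  case less
  let ?adj = "successively (\<lambda>i j. {i, j} \<in> E)"
  obtain vs where zs: "zs = vs @ [i]"
    using less.prems unfolding walk_between_def by (metis append_butlast_last_id)
  have adj: "?adj zs" and hd: "hd zs = i" using less.prems by (simp_all add: walk_between_def)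
  show ?case
  proof (cases "distinct vs")
    case True
    consider "vs = []" | x where "vs = [x]" | x y where "vs = [x, y]" | "3 \<le> length vs"
      by (cases vs rule: remdups_adj.cases; cases "tl (tl vs)") auto
    then show ?thesis
    proof cases
      case 1
      then show ?thesis by (simp add: zs rcl_Nil)
    next
      case (2 x)
      then show ?thesis using adj hd edge_neq[of i i] by (simp add: zs)
    next
      case (3 x y)
      then have xy: "i = x" "{x, y} \<in> E" using adj hd by (auto simp: zs)
      then have "rcl (inv_word (r_word y x) @ r_word y x) = rcl []"
        using pres_eq_inv_word[of "r_word y x"] r_word_in_words[of y x] inv_word_in_words
        by (subst pres_class_eq_iff) (auto simp: insert_commute)
      then show ?thesis
        using 3 xy edge_neq[of x y] r_word_swap[of y x] by (simp add: zs rcl_Nil)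
    next
      case 4
      then have "hd vs = i" using hd by (cases vs) (auto simp: zs)
      then have "graph_cycle E vs" using 4 True adj by (simp add: graph_cycle_def zs)
      then have "(walk_word (vs @ [hd vs]), []) \<in> alt_rels m E"
        unfolding alt_rels_def by blast
      then have "rcl (walk_word zs) = rcl []"
        using \<open>hd vs = i\<close> walk_word_in_words[OF adj] by (intro rcl_rel) (simp_all add: zs)
      then show ?thesis by (simp add: rcl_Nil)
    qed
  next
    case False
    then obtain as y bs cs where vs: "vs = as @ [y] @ bs @ [y] @ cs"
      using not_distinct_decomp by blast
    let ?in = "y # bs @ [y]" and ?out = "as @ [y] @ cs @ [i]"
    have adj': "?adj (as @ [y])" "?adj ?in" "?adj (y # cs @ [i])" "?adj ?out"
      using adj by (auto simp: zs vs successively_append_iff successively_Cons hd_append)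
    have "walk_between E y y ?in" "walk_between E i i ?out"
      using adj' hd by (auto simp: walk_between_def zs vs hd_append)
    then have "rcl (walk_word ?in) = \<one>\<^bsub>P\<^esub>" "rcl (walk_word ?out) = \<one>\<^bsub>P\<^esub>"
      by (intro less.hyps; simp add: zs vs)+
    moreover have "walk_word zs = walk_word (as @ [y]) @ walk_word ?in @ walk_word (y # cs @ [i])"
      using walk_word_append[of as y "bs @ [y] @ cs @ [i]"]
        walk_word_append[of "y # bs" y "cs @ [i]"] by (simp add: zs vs)
    moreover have "walk_word ?out = walk_word (as @ [y]) @ walk_word (y # cs @ [i])"
      using walk_word_append[of as y "cs @ [i]"] by simp
    ultimately show ?thesis
      using adj'(1-3)[THEN walk_word_in_words] by (simp add: rcl_append rcl_closed)
  qed
qed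

lemma walk_class_unique:
  assumes xs: "walk_between E i j xs" and ys: "walk_between E i j ys"
  shows "rcl (walk_word xs) = rcl (walk_word ys)"
proof -
  let ?adj = "successively (\<lambda>i j. {i, j} \<in> E)"
  obtain xs' where xs': "xs = xs' @ [j]"
    using xs unfolding walk_between_def by (metis append_butlast_last_id)
  obtain ys' where ys': "ys = ys' @ [j]"
    using ys unfolding walk_between_def by (metis append_butlast_last_id)
  have adj: "?adj xs" "?adj ys" "?adj (rev ys)"
    using xs ys by (simp_all add: walk_between_def insert_commute)
  have "successively (\<noteq>) ys"
    by (rule successively_mono[OF adj(2)]) (simp add: edge_neq)
  from walk_word_rev[OF this] have "rcl (walk_word (rev ys)) = inv\<^bsub>P\<^esub> (rcl (walk_word ys))"
    using walk_word_in_words[OF adj(2)] by (simp add: pres_class_inv_word)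
  moreover have "walk_between E i i (xs' @ [j] @ rev ys')"
    using xs ys adj
    by (auto simp: walk_between_def xs' ys' successively_append_iff successively_Cons hd_append
        last_rev hd_rev)
  then have "rcl (walk_word xs @ walk_word (rev ys)) = \<one>\<^bsub>P\<^esub>"
    using closed_walk_trivial[of i "xs' @ [j] @ rev ys'"] walk_word_append[of xs' j "rev ys'"]
    by (simp add: xs' ys')
  ultimately have "rcl (walk_word xs) \<otimes>\<^bsub>P\<^esub> inv\<^bsub>P\<^esub> (rcl (walk_word ys)) = \<one>\<^bsub>P\<^esub>"
    using adj[THEN walk_word_in_words] by (simp add: rcl_append)
  then show ?thesis
    using adj[THEN walk_word_in_words] P.inv_equality[of "rcl (walk_word xs)" "inv\<^bsub>P\<^esub> (rcl (walk_word ys))"]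
    by (simp add: rcl_closed)
qed

text \<open>The element that \<open>s\<^sub>i s\<^sub>j\<close> has to correspond to; any walk from \<open>i\<close> to \<open>j\<close> may be used.\<close>

definition R :: "nat \<Rightarrow> nat \<Rightarrow> (nat \<times> nat) word set" where
  "R i j = rcl (walk_word (SOME xs. walk_between E i j xs))"

lemma R_walk:
  assumes "walk_between E i j xs"
  shows "R i j = rcl (walk_word xs)"
  unfolding R_def using assms by (metis someI walk_class_unique)

lemma walk_obtains:
  assumes "i < n" "j < n"
  obtains xs where "walk_between E i j xs" "chordless E xs"
  using walk_exists[OF connected[OF assms]] chordless_walk_exists by blast

lemma R_closed [simp]:
  assumes "i < n" "j < n" shows "R i j \<in> carrier P"
proof -
  obtain xs where "walk_between E i j xs" using walk_obtains[OF assms] by blast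
  then show ?thesis by (simp add: R_walk rcl_closed walk_word_in_words walk_between_def)
qed

lemma R_mult:
  assumes "i < n" "j < n" "k < n"
  shows "R i j \<otimes>\<^bsub>P\<^esub> R j k = R i k"
proof -
  obtain xs where xs: "walk_between E i j xs" using walk_obtains assms by blast
  obtain ys where ys: "walk_between E j k ys" using walk_obtains assms by blast
  obtain xs' where xs': "xs = xs' @ [j]"
    using xs unfolding walk_between_def by (metis append_butlast_last_id)
  obtain ys' where ys': "ys = j # ys'"
    using ys unfolding walk_between_def by (metis list.collapse)
  have "walk_between E i k (xs' @ [j] @ ys')"
    using xs ys by (auto simp: walk_between_def xs' ys' successively_append_iff successively_Cons hd_append)
  then show ?thesis
    using R_walk[OF xs] R_walk[OF ys] R_walk[of i k "xs' @ [j] @ ys'"] walk_word_append[of xs' j ys']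
      walk_word_in_words[of xs] walk_word_in_words[of ys] xs ys
    by (simp add: walk_between_def xs' ys' rcl_append)
qed

lemma R_diag: "R i i = \<one>\<^bsub>P\<^esub>"
  using R_walk[of i i "[i]"] by (simp add: walk_between_def rcl_Nil)

lemma R_inv: "\<lbrakk>i < n; j < n\<rbrakk> \<Longrightarrow> inv\<^bsub>P\<^esub> (R i j) = R j i"
  by (rule P.inv_equality) (simp_all add: R_mult R_diag)

lemma R_edge: "{i, j} \<in> E \<Longrightarrow> R i j = rcl (r_word i j)"
  using R_walk[of i j "[i, j]"] by (simp add: walk_between_def)

lemma R_pow_swap:
  "\<lbrakk>i < n; j < n; R i j [^]\<^bsub>P\<^esub> (k::nat) = \<one>\<^bsub>P\<^esub>\<rbrakk> \<Longrightarrow> R j i [^]\<^bsub>P\<^esub> k = \<one>\<^bsub>P\<^esub>"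
  using P.nat_pow_inv[of "R i j" k] by (simp add: R_inv)

text \<open>The presentation states each power relation for one direction only; \<open>R_pow_swap\<close> supplies the
  other.\<close>

lemma R_pow_edge:
  assumes E: "{i, j} \<in> E" and k: "m i j = enat k"
  shows "R i j [^]\<^bsub>P\<^esub> k = \<one>\<^bsub>P\<^esub>"
proof -
  have *: "R i j [^]\<^bsub>P\<^esub> k = \<one>\<^bsub>P\<^esub>" if "i < j" "{i, j} \<in> E" "m i j = enat k" for i j
  proof -
    have "(i, j) \<in> alt_gens E" using that by (simp add: alt_gens_def)
    then have "(word_pow (r_word i j) k, []) \<in> alt_rels m E"
      using that(3) unfolding alt_rels_def by blast
    then show ?thesis
      using rcl_rel[of "word_pow (r_word i j) k" "[]"] r_word_in_words[OF that(2)]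
      by (simp add: word_pow_in_words pres_class_word_pow R_edge[OF that(2)] rcl_Nil)
  qed
  have ij: "i < n" "j < n" "i \<noteq> j" using E[THEN edgeD] by simp_all
  then consider "i < j" | "j < i" by linarith
  then show ?thesis
  proof cases
    case 1
    then show ?thesis using *[of i j] assms by simp
  next
    case 2
    then have "R j i [^]\<^bsub>P\<^esub> k = \<one>\<^bsub>P\<^esub>"
      using *[of j i] assms m_sym[of i j] ij by (simp add: insert_commute)
    then show ?thesis by (rule R_pow_swap[OF ij(2,1)])
  qed
qed

lemma R_square_two_steps:
  assumes E: "{i, j} \<in> E" "{j, k} \<in> E" and "i \<noteq> k" "m i k = 2"
  shows "R i k [^]\<^bsub>P\<^esub> (2::nat) = \<one>\<^bsub>P\<^esub>"
proof -
  have *: "R i k [^]\<^bsub>P\<^esub> (2::nat) = \<one>\<^bsub>P\<^esub>"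
    if "{i, j} \<in> E" "{j, k} \<in> E" "i < k" "m i k = 2" for i k
  proof -
    have w: "r_word i j @ r_word j k \<in> words (alt_gens E)"
      using that(1,2)[THEN r_word_in_words] by simp
    have "(word_pow (r_word i j @ r_word j k) 2, []) \<in> alt_rels m E"
      using that unfolding alt_rels_def by blast
    then have "rcl (r_word i j @ r_word j k) [^]\<^bsub>P\<^esub> (2::nat) = \<one>\<^bsub>P\<^esub>"
      using rcl_rel[OF _ word_pow_in_words[OF w], of 2 "[]"] pres_class_word_pow[OF w]
      by (simp add: rcl_Nil)
    then show ?thesis
      using that R_walk[of i k "[i, j, k]"] by (simp add: walk_between_def)
  qed
  have ik: "i < n" "k < n" using E[THEN edgeD] by simp_all
  show ?thesis
  proof (cases "i < k")
    case False
    then have "R k i [^]\<^bsub>P\<^esub> (2::nat) = \<one>\<^bsub>P\<^esub>"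
      using assms m_sym[of i k] ik by (intro *) (auto simp: insert_commute)
    then show ?thesis by (rule R_pow_swap[OF ik(2,1)])
  qed (use *[of i k] assms in simp)
qed

lemma R_square_three_steps:
  assumes E: "{i, j} \<in> E" "{j, k} \<in> E" "{k, l} \<in> E" and "i \<noteq> l" "m i l = 2"
  shows "R i l [^]\<^bsub>P\<^esub> (2::nat) = \<one>\<^bsub>P\<^esub>"
proof -
  have *: "R i l [^]\<^bsub>P\<^esub> (2::nat) = \<one>\<^bsub>P\<^esub>"
    if "{i, j} \<in> E" "{j, k} \<in> E" "{k, l} \<in> E" "i < l" "m i l = 2" for i j k l
  proof -
    have w: "r_word i j @ r_word j k @ r_word k l \<in> words (alt_gens E)"
      using that(1-3)[THEN r_word_in_words] by simp
    have "(word_pow (r_word i j @ r_word j k @ r_word k l) 2, []) \<in> alt_rels m E"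
      using that unfolding alt_rels_def by blast
    then have "rcl (r_word i j @ r_word j k @ r_word k l) [^]\<^bsub>P\<^esub> (2::nat) = \<one>\<^bsub>P\<^esub>"
      using rcl_rel[OF _ word_pow_in_words[OF w], of 2 "[]"] pres_class_word_pow[OF w]
      by (simp add: rcl_Nil)
    then show ?thesis
      using that R_walk[of i l "[i, j, k, l]"] by (simp add: walk_between_def)
  qed
  have il: "i < n" "l < n" using E[THEN edgeD] by simp_all
  show ?thesis
  proof (cases "i < l")
    case False
    then have "R l i [^]\<^bsub>P\<^esub> (2::nat) = \<one>\<^bsub>P\<^esub>"
      using assms m_sym[of i l] il by (intro *[of l k j i]) (auto simp: insert_commute)
    then show ?thesis by (rule R_pow_swap[OF il(2,1)])
  qed (use *[of i j k l] assms in simp)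
qed

text \<open>The relation is given for generators, that is for \<open>i < j\<close> and \<open>k < l\<close>; the other orientations
  follow because an element that commutes with \<open>x\<close> commutes with its inverse.\<close>

lemma R_commute:
  assumes E: "{i, j} \<in> E" "{k, l} \<in> E" and nc: "not_connected E (i, j) (k, l)"
  shows "R i j \<otimes>\<^bsub>P\<^esub> R k l = R k l \<otimes>\<^bsub>P\<^esub> R i j"
proof -
  have swap: "R j i \<otimes>\<^bsub>P\<^esub> R k l = R k l \<otimes>\<^bsub>P\<^esub> R j i"
    if "R i j \<otimes>\<^bsub>P\<^esub> R k l = R k l \<otimes>\<^bsub>P\<^esub> R i j" "i < n" "j < n" "k < n" "l < n" for i j k l
  proof -
    have "R j i \<otimes>\<^bsub>P\<^esub> R k l = R j i \<otimes>\<^bsub>P\<^esub> (R k l \<otimes>\<^bsub>P\<^esub> R i j) \<otimes>\<^bsub>P\<^esub> R j i"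
      using that by (simp add: P.m_assoc R_mult R_diag)
    also have "\<dots> = R j i \<otimes>\<^bsub>P\<^esub> (R i j \<otimes>\<^bsub>P\<^esub> R k l) \<otimes>\<^bsub>P\<^esub> R j i"
      by (simp only: that(1))
    also have "\<dots> = (R j i \<otimes>\<^bsub>P\<^esub> R i j) \<otimes>\<^bsub>P\<^esub> R k l \<otimes>\<^bsub>P\<^esub> R j i"
      using that by (simp only: P.m_assoc R_closed P.m_closed)
    also have "\<dots> = R k l \<otimes>\<^bsub>P\<^esub> R j i"
      using that by (simp add: R_mult R_diag)
    finally show ?thesis .
  qed
  have sorted: "R i j \<otimes>\<^bsub>P\<^esub> R k l = R k l \<otimes>\<^bsub>P\<^esub> R i j"
    if E: "{i, j} \<in> E" "{k, l} \<in> E" and nc: "not_connected E (i, j) (k, l)" and "i < j" "k < l"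
    for i j k l
  proof -
    have "(r_word i j @ r_word k l, r_word k l @ r_word i j) \<in> alt_rels m E"
      using that unfolding alt_rels_def alt_gens_def by blast
    then have "rcl (r_word i j @ r_word k l) = rcl (r_word k l @ r_word i j)"
      using E[THEN r_word_in_words] by (intro rcl_rel) simp_all
    then show ?thesis
      using E[THEN r_word_in_words] by (simp add: rcl_append R_edge E)
  qed
  have v: "i < n" "j < n" "k < n" "l < n" "i \<noteq> j" "k \<noteq> l"
    using E[THEN edgeD] by simp_all
  have nc': "not_connected E (j, i) (k, l)" "not_connected E (i, j) (l, k)"
      "not_connected E (j, i) (l, k)"
    using nc by (auto simp: not_connected_def insert_commute)
  consider "i < j" "k < l" | "j < i" "k < l" | "i < j" "l < k" | "j < i" "l < k"
    using v by linarith
  then show ?thesis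
  proof cases
    case 1
    then show ?thesis using sorted[of i j k l] E nc by simp
  next
    case 2
    then show ?thesis using sorted[of j i k l] swap[of j i k l] E nc' v by (simp add: insert_commute)
  next
    case 3
    then show ?thesis
      using sorted[of i j l k] swap[of l k i j] E nc' v by (simp add: insert_commute)
  next
    case 4
    then have "R j i \<otimes>\<^bsub>P\<^esub> R l k = R l k \<otimes>\<^bsub>P\<^esub> R j i"
      using sorted[of j i l k] E nc' by (simp add: insert_commute)
    then have "R i j \<otimes>\<^bsub>P\<^esub> R l k = R l k \<otimes>\<^bsub>P\<^esub> R i j"
      using swap[of j i l k] v by simp
    then show ?thesis using swap[of l k i j] v by simp
  qed
qed

text \<open>The endpoints of a chordless walk with at least two steps are distinct and not joined, so \<open>m\<^sub>i\<^sub>j = 2\<close>.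
  Chordlessness passes to the shorter walks, and with at least four steps it also makes the first
  and the last edge not connected.\<close>

lemma R_square_chordless:
  assumes "walk_between E i j xs" "chordless E xs" "3 \<le> length xs"
  shows "R i j [^]\<^bsub>P\<^esub> (2::nat) = \<one>\<^bsub>P\<^esub>"
  using assms
proof (induction "length xs" arbitrary: i j xs rule: less_induct)
  case less
  let ?adj = "successively (\<lambda>i j. {i, j} \<in> E)"
  have ij: "i < n" "j < n" "i \<noteq> j" "{i, j} \<notin> E"
  proof -
    have "xs = i # tl xs" "tl xs = butlast (tl xs) @ [j]"
      using less.prems(1,3) by (auto simp: walk_between_def) (cases xs; auto)+
    then have eq: "xs = [] @ i # butlast (tl xs) @ j # []" by simp
    moreover have ne: "butlast (tl xs) \<noteq> []" using less.prems(3) by (cases xs rule: remdups_adj.cases) auto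
    ultimately show "i \<noteq> j" "{i, j} \<notin> E" using less.prems(2) unfolding chordless_def by blast+
    have "?adj (i # butlast (tl xs) @ [j])" using less.prems(1) eq by (simp add: walk_between_def)
    then have "{i, hd (butlast (tl xs))} \<in> E" "{last (butlast (tl xs)), j} \<in> E"
      using ne by (auto simp: successively_append_iff successively_Cons)
    from this[THEN edgeD] show "i < n" "j < n" by simp_all
  qed
  then have m: "m i j = 2" by (rule non_edge)
  consider y where "xs = [i, y, j]" | y z where "xs = [i, y, z, j]"
    | y ms z where "xs = i # y # ms @ [z, j]" "ms \<noteq> []"
  proof -
    obtain y t where t: "xs = i # y # t" "t \<noteq> []"
      using less.prems(1,3) by (auto simp: numeral_3_eq_3 Suc_le_length_iff walk_between_def)
    then obtain t' where t': "t = t' @ [j]"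
      using less.prems(1) unfolding walk_between_def
      by (metis append_butlast_last_id last_ConsR list.discI)
    consider "t' = []" | z where "t' = [z]" | ms z where "t' = ms @ [z]" "ms \<noteq> []"
      by (metis append_Nil rev_exhaust)
    then show thesis
    proof cases
      case 1
      then show thesis using that(1)[of y] t(1) t' by simp
    next
      case (2 z)
      then show thesis using that(2)[of y z] t(1) t' by simp
    next
      case (3 ms z)
      then show thesis using that(3)[of y ms z] t(1) t' by simp
    qed
  qed
  then show ?case
  proof cases
    case (1 y)
    then show ?thesis
      using R_square_two_steps[of i y j] less.prems(1) ij m by (simp add: walk_between_def)
  next
    case (2 y z)
    then show ?thesis
      using R_square_three_steps[of i y z j] less.prems(1) ij m by (simp add: walk_between_def)
  next
    case (3 y ms z)
    note xs = 3
    have adj: "?adj (i # y # ms @ [z, j])" using less.prems(1) by (simp add: xs walk_between_def)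
    have ch: "chordless E (i # y # ms @ [z, j])" using less.prems(2) by (simp add: xs)
    have E: "{i, y} \<in> E" "{z, j} \<in> E" using adj by (auto simp: successively_append_iff successively_Cons)
    from E[THEN edgeD] have v: "y < n" "z < n" by simp_all
    have yz: "R y z [^]\<^bsub>P\<^esub> (2::nat) = \<one>\<^bsub>P\<^esub>"
    proof (rule less.hyps[of "y # ms @ [z]"])
      show "walk_between E y z (y # ms @ [z])"
        using adj xs
        by (auto simp: walk_between_def successively_append_iff successively_Cons hd_append)
      show "chordless E (y # ms @ [z])" using chordless_infix[of E "[i]" _ "[j]"] ch by simp
    qed (use xs in \<open>simp_all add: Suc_le_eq\<close>)
    have iz: "R i z [^]\<^bsub>P\<^esub> (2::nat) = \<one>\<^bsub>P\<^esub>"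
    proof (rule less.hyps[of "i # y # ms @ [z]"])
      show "walk_between E i z (i # y # ms @ [z])"
        using adj xs
        by (auto simp: walk_between_def successively_append_iff successively_Cons hd_append)
      show "chordless E (i # y # ms @ [z])" using chordless_infix[of E "[]" _ "[j]"] ch by simp
    qed (use xs in simp_all)
    have yj: "R y j [^]\<^bsub>P\<^esub> (2::nat) = \<one>\<^bsub>P\<^esub>"
    proof (rule less.hyps[of "y # ms @ [z, j]"])
      show "walk_between E y j (y # ms @ [z, j])"
        using adj xs
        by (auto simp: walk_between_def successively_append_iff successively_Cons hd_append)
      show "chordless E (y # ms @ [z, j])" using chordless_infix[of E "[i]" _ "[]"] ch by simp
    qed (use xs in simp_all)
    have "i \<noteq> z \<and> {i, z} \<notin> E" "y \<noteq> z \<and> {y, z} \<notin> E" "y \<noteq> j \<and> {y, j} \<notin> E"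
      using ch[unfolded chordless_def, rule_format, of "[]" i "y # ms" z "[j]"]
        ch[unfolded chordless_def, rule_format, of "[i]" y ms z "[j]"]
        ch[unfolded chordless_def, rule_format, of "[i]" y "ms @ [z]" j "[]"] xs by auto
    then have "not_connected E (i, y) (z, j)" using ij by (auto simp: not_connected_def)
    then have "R i y \<otimes>\<^bsub>P\<^esub> R z j = R z j \<otimes>\<^bsub>P\<^esub> R i y" by (rule R_commute[OF E])
    then have "(R i y \<otimes>\<^bsub>P\<^esub> R y z \<otimes>\<^bsub>P\<^esub> R z j) [^]\<^bsub>P\<^esub> (2::nat) = \<one>\<^bsub>P\<^esub>"
      using yz iz yj ij v by (intro P.square_of_triple_product) (simp_all add: R_mult)
    then show ?thesis using ij v by (simp add: R_mult)
  qed
qed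

lemma R_pow:
  assumes "i < n" "j < n" and k: "m i j = enat k"
  shows "R i j [^]\<^bsub>P\<^esub> k = \<one>\<^bsub>P\<^esub>"
proof -
  consider "i = j" | "{i, j} \<in> E" | "i \<noteq> j" "{i, j} \<notin> E" by blast
  then show ?thesis
  proof cases
    case 1
    then show ?thesis by (simp add: R_diag)
  next
    case 2
    then show ?thesis using R_pow_edge k by blast
  next
    case 3
    then have "k = 2" using non_edge[of i j] assms by (simp add: numeral_eq_enat)
    obtain xs where xs: "walk_between E i j xs" "chordless E xs"
      using walk_obtains assms by blast
    have "3 \<le> length xs"
    proof (rule ccontr)
      assume "\<not> 3 \<le> length xs"
      then consider "xs = []" | x where "xs = [x]" | x y where "xs = [x, y]"
        by (cases xs rule: remdups_adj.cases; cases "tl (tl xs)") auto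
      then show False using xs(1) 3 by cases (auto simp: walk_between_def)
    qed
    with xs show ?thesis unfolding \<open>k = 2\<close> by (rule R_square_chordless)
  qed
qed

sublocale cocycle: coxeter_cocycle n m P R
  by unfold_locales (simp_all add: R_mult R_pow)


section \<open>The isomorphism\<close>

abbreviation "\<phi>\<^sub>0 \<equiv> \<lambda>(i, j). s i \<otimes>\<^bsub>W\<^esub> s j"

lemma \<phi>\<^sub>0_in_Alt: "x \<in> alt_gens E \<Longrightarrow> \<phi>\<^sub>0 x \<in> Alt"
  using edge_less edge_less2 by (auto simp: alt_gens_def s_s_in_Alt)

lemma \<phi>\<^sub>0_closed: "x \<in> alt_gens E \<Longrightarrow> \<phi>\<^sub>0 x \<in> carrier W"
  using \<phi>\<^sub>0_in_Alt subgroup.subset[OF subgroup_Alt] by blast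

lemma eval_r_word:
  assumes "{i, j} \<in> E"
  shows "word_eval W \<phi>\<^sub>0 (r_word i j) = s i \<otimes>\<^bsub>W\<^esub> s j"
proof -
  have "i < n" "j < n" using edgeD[OF assms] by simp_all
  then show ?thesis by (simp add: r_word_def W.inv_mult_group s_inv)
qed

lemma s_s_cancel:
  "\<lbrakk>i < n; j < n; k < n\<rbrakk> \<Longrightarrow> s i \<otimes>\<^bsub>W\<^esub> s j \<otimes>\<^bsub>W\<^esub> (s j \<otimes>\<^bsub>W\<^esub> s k) = s i \<otimes>\<^bsub>W\<^esub> s k"
  by (metis W.l_one W.m_assoc W.m_closed s_closed s_square)

text \<open>The product telescopes.\<close>

lemma eval_walk_word:
  assumes "walk_between E i j xs" "i < n"
  shows "word_eval W \<phi>\<^sub>0 (walk_word xs) = s i \<otimes>\<^bsub>W\<^esub> s j"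
  using assms
proof (induction xs arbitrary: i rule: walk_word.induct)
  case (1 x y vs)
  then have E: "{i, y} \<in> E" "i = x" and w: "walk_between E y j (y # vs)"
    by (auto simp: walk_between_def)
  have y: "y < n" using edgeD[OF E(1)] by simp
  have j: "j < n"
    using w y
  proof (induction vs arbitrary: y)
    case (Cons z zs)
    then have "{y, z} \<in> E" "walk_between E z j (z # zs)" by (auto simp: walk_between_def)
    then show ?case using Cons.IH[of z] edgeD[of y z] by simp
  qed (simp add: walk_between_def)
  have "word_eval W \<phi>\<^sub>0 (walk_word (x # y # vs)) =
      word_eval W \<phi>\<^sub>0 (r_word x y) \<otimes>\<^bsub>W\<^esub> word_eval W \<phi>\<^sub>0 (walk_word (y # vs))"
    using E w r_word_in_words walk_word_in_words
    by (simp add: W.word_eval_append[of "alt_gens E", OF \<phi>\<^sub>0_closed] walk_between_def)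
  then show ?case
    using 1(1)[OF w y] E y j 1(3) by (simp add: eval_r_word s_s_cancel)
qed (auto simp: walk_between_def)

lemma eval_rel:
  assumes "(u, v) \<in> alt_rels m E"
  shows "word_eval W \<phi>\<^sub>0 u = word_eval W \<phi>\<^sub>0 v"
proof -
  have pow: "word_eval W \<phi>\<^sub>0 (word_pow (walk_word xs) k) = \<one>\<^bsub>W\<^esub>"
    if "walk_between E i j xs" "i < j" "i < n" "j < n" "m i j = enat k" for i j k xs
    using that s_pow[of i j k] walk_word_in_words[of xs]
    by (simp add: W.word_eval_word_pow[of "alt_gens E", OF \<phi>\<^sub>0_closed] eval_walk_word walk_between_def)
  show ?thesis
    using assms unfolding alt_rels_def Un_iff
  proof (elim disjE)
    assume "(u, v) \<in> {(word_pow (r_word i j) k, []) | i j k. (i, j) \<in> alt_gens E \<and> m i j = enat k}"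
    then obtain i j k where u: "u = word_pow (r_word i j) k" "v = []"
      and ij: "(i, j) \<in> alt_gens E" "m i j = enat k" by blast
    then show ?thesis
      using pow[of i j "[i, j]" k] edge_less[of i j] edge_less2[of i j]
      by (simp add: walk_between_def alt_gens_def)
  next
    assume "(u, v) \<in> {(walk_word (vs @ [hd vs]), []) | vs. graph_cycle E vs}"
    then obtain vs where u: "u = walk_word (vs @ [hd vs])" "v = []" and vs: "graph_cycle E vs" by blast
    then obtain x y zs where xyz: "vs = x # y # zs"
      by (cases vs rule: remdups_adj.cases) (auto simp: graph_cycle_def)
    then have "walk_between E x x (vs @ [hd vs])" "{x, y} \<in> E"
      using vs by (auto simp: walk_between_def graph_cycle_def)
    then show ?thesis using eval_walk_word[of x x] edge_less[of x y] u by simp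
  next
    assume "(u, v) \<in> {(word_pow (r_word i j @ r_word j k) 2, []) | i j k.
       {i, j} \<in> E \<and> {j, k} \<in> E \<and> i < k \<and> m i k = 2}"
    then obtain i j k where u: "u = word_pow (r_word i j @ r_word j k) 2" "v = []"
      and ij: "{i, j} \<in> E" "{j, k} \<in> E" "i < k" "m i k = 2" by blast
    then show ?thesis
      using pow[of i k "[i, j, k]" 2] edge_less[of i j] edge_less2[of j k]
      by (simp add: walk_between_def numeral_eq_enat)
  next
    assume "(u, v) \<in> {(word_pow (r_word i j @ r_word j k @ r_word k l) 2, []) | i j k l.
       {i, j} \<in> E \<and> {j, k} \<in> E \<and> {k, l} \<in> E \<and> i < l \<and> m i l = 2}"
    then obtain i j k l where u: "u = word_pow (r_word i j @ r_word j k @ r_word k l) 2" "v = []"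
      and ij: "{i, j} \<in> E" "{j, k} \<in> E" "{k, l} \<in> E" "i < l" "m i l = 2" by blast
    then show ?thesis
      using pow[of i l "[i, j, k, l]" 2] edge_less[of i j] edge_less2[of k l]
      by (simp add: walk_between_def numeral_eq_enat)
  next
    assume "(u, v) \<in> {(r_word i j @ r_word k l, r_word k l @ r_word i j) | i j k l.
       (i, j) \<in> alt_gens E \<and> (k, l) \<in> alt_gens E \<and> not_connected E (i, j) (k, l)}"
    then obtain i j k l where u: "u = r_word i j @ r_word k l" "v = r_word k l @ r_word i j"
      and E: "{i, j} \<in> E" "{k, l} \<in> E" and nc: "not_connected E (i, j) (k, l)"
      unfolding alt_gens_def by blast
    have v: "i < n" "j < n" "k < n" "l < n" using E[THEN edgeD] by simp_all
    have c: "s a \<otimes>\<^bsub>W\<^esub> s b = s b \<otimes>\<^bsub>W\<^esub> s a" if "a \<in> {i, j}" "b \<in> {k, l}" for a b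
      using that nc v by (intro s_commute non_edge) (auto simp: not_connected_def)
    have "(s i \<otimes>\<^bsub>W\<^esub> s j) \<otimes>\<^bsub>W\<^esub> (s k \<otimes>\<^bsub>W\<^esub> s l) = (s k \<otimes>\<^bsub>W\<^esub> s l) \<otimes>\<^bsub>W\<^esub> (s i \<otimes>\<^bsub>W\<^esub> s j)"
      by (intro W.mult_commutes W.mult_commutes[symmetric])
        (use v c[of i k, symmetric] c[of i l, symmetric] c[of j k, symmetric] c[of j l, symmetric]
          in simp_all)
    then show ?thesis
      using E[THEN r_word_in_words]
      by (simp add: u W.word_eval_append[of "alt_gens E", OF \<phi>\<^sub>0_closed] eval_r_word E)
  qed
qed

definition \<phi> :: "(nat \<times> nat) word set \<Rightarrow> nat word set" where
  "\<phi> = pres_lift W \<phi>\<^sub>0"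

lemma \<phi>_hom: "\<phi> \<in> hom P W"
  unfolding \<phi>_def by (rule W.pres_lift_hom[OF \<phi>\<^sub>0_closed eval_rel])

lemma \<phi>_class: "u \<in> words (alt_gens E) \<Longrightarrow> \<phi> (rcl u) = word_eval W \<phi>\<^sub>0 u"
  unfolding \<phi>_def by (rule W.pres_lift_class[OF \<phi>\<^sub>0_closed eval_rel])

lemma \<phi>_in_Alt: "A \<in> carrier P \<Longrightarrow> \<phi> A \<in> Alt"
  using W.word_eval_in_subgroup[OF subgroup_Alt \<phi>\<^sub>0_in_Alt] \<phi>_class
  by (auto simp: presented_group_def)

lemma \<phi>_R:
  assumes "i < n" "j < n"
  shows "\<phi> (R i j) = s i \<otimes>\<^bsub>W\<^esub> s j"
proof -
  obtain xs where xs: "walk_between E i j xs" using walk_obtains[OF assms] by blast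
  then have "walk_word xs \<in> words (alt_gens E)" by (simp add: walk_between_def walk_word_in_words)
  then show ?thesis using xs assms by (simp add: R_walk \<phi>_class eval_walk_word)
qed

abbreviation "\<psi> \<equiv> cocycle.alt_lift"

lemma \<psi>_mult: "\<lbrakk>A \<in> Alt; B \<in> Alt\<rbrakk> \<Longrightarrow> \<psi> (A \<otimes>\<^bsub>W\<^esub> B) = \<psi> A \<otimes>\<^bsub>P\<^esub> \<psi> B"
  using hom_mult[OF cocycle.alt_lift_hom] by simp

lemma \<psi>_closed: "A \<in> Alt \<Longrightarrow> \<psi> A \<in> carrier P"
  using hom_in_carrier[OF cocycle.alt_lift_hom] by simp

lemma \<phi>_\<psi>: "A \<in> Alt \<Longrightarrow> \<phi> (\<psi> A) = A"
proof (induction A rule: Alt_induct)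
  case one
  have "\<psi> \<one>\<^bsub>W\<^esub> = \<one>\<^bsub>P\<^esub>"
    using cocycle.alt_lift_class[of "[]"] by (simp add: cox_class_Nil)
  then show ?case using hom_one[OF \<phi>_hom P.group_axioms W.group_axioms] by simp
next
  case (mult i j B)
  then show ?case
    by (simp add: \<psi>_mult s_s_in_Alt cocycle.alt_lift_gen hom_mult[OF \<phi>_hom] \<psi>_closed \<phi>_R)
qed

lemma \<psi>_\<phi>:
  assumes "A \<in> carrier P"
  shows "\<psi> (\<phi> A) = A"
proof -
  have "\<psi> \<circ> \<phi> \<in> hom P P"
    by (rule homI) (simp_all add: \<phi>_in_Alt \<psi>_closed \<psi>_mult hom_mult[OF \<phi>_hom])
  moreover have "(\<psi> \<circ> \<phi>) (rcl [(x, True)]) = rcl [(x, True)]" if x: "x \<in> alt_gens E" for x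
  proof -
    obtain i j where x: "x = (i, j)" "i < j" "{i, j} \<in> E"
      using x by (auto simp: alt_gens_def)
    then have "R i j = rcl [(x, True)]" by (simp add: R_edge r_word_def)
    moreover have "i < n" "j < n" using edgeD[OF x(3)] by simp_all
    ultimately show ?thesis
      using \<phi>_R[of i j] cocycle.alt_lift_gen[of i j] by simp
  qed
  ultimately have "(\<psi> \<circ> \<phi>) A = A"
    using assms by (rule presented_group_hom_fixing_generators)
  then show ?thesis by simp
qed

theorem alternating_presentation: "W\<lparr>carrier := Alt\<rparr> \<cong> P"
proof -
  have "bij_betw \<psi> Alt (carrier P)"
    using \<phi>_\<psi> \<psi>_\<phi> \<phi>_in_Alt \<psi>_closed by (intro bij_betw_byWitness[where f' = \<phi>]) auto
  then have "\<psi> \<in> iso (W\<lparr>carrier := Alt\<rparr>) P"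
    using cocycle.alt_lift_hom by (simp add: iso_def)
  then show ?thesis unfolding is_iso_def by blast
qed

end

text \<open>The virtual edges chain the chosen vertices together, and each vertex is connected to the chosen
  vertex of its component. A virtual edge joins different components, so it is not a loop.\<close>

lemma connected_extension_graph:
  assumes "coxeter_matrix n m" and "connected_extension n m E"
  shows "coxeter_graph n m E"
proof -
  interpret coxeter n m by unfold_locales (rule assms(1))
  let ?C = "coxeter_edges n m"
  let ?c = "{(i, j). {i, j} \<in> ?C}" and ?e = "{(i, j). {i, j} \<in> E}"
  obtain Cs vs where Cs: "distinct Cs" "set Cs = graph_components n ?C"
    and len: "length vs = length Cs" and vs: "\<And>a. a < length Cs \<Longrightarrow> vs ! a \<in> Cs ! a"
    and E: "E = ?C \<union> {{vs ! l, vs ! Suc l} | l. Suc l < length vs}"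
    using assms(2) unfolding connected_extension_def by blast
  have cox_edge: "{i, j} \<in> ?C \<longleftrightarrow> i < n \<and> j < n \<and> i \<noteq> j \<and> 3 \<le> m i j" for i j
    using m_sym[of i j] by (auto simp: coxeter_edges_def doubleton_eq_iff)
  have c_sym: "(j, i) \<in> ?c\<^sup>*" if "(i, j) \<in> ?c\<^sup>*" for i j
  proof -
    have "sym ?c" by (auto simp: sym_def insert_commute)
    then show ?thesis using that sym_rtrancl symD by metis
  qed
  have c_less: "j < n" if "(i, j) \<in> ?c\<^sup>*" "i < n" for i j
    using that by (induction rule: rtrancl_induct) (simp_all add: cox_edge)
  have component: "\<exists>i<n. C = ?c\<^sup>* `` {i}" if "C \<in> set Cs" for C
    using that unfolding Cs(2) graph_components_def quotient_def by auto
  have vs_component: "Cs ! a = ?c\<^sup>* `` {vs ! a}" and vs_less: "vs ! a < n" if a: "a < length Cs" for a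
  proof -
    obtain i where i: "i < n" "Cs ! a = ?c\<^sup>* `` {i}" using component[of "Cs ! a"] a by auto
    then have *: "(i, vs ! a) \<in> ?c\<^sup>*" using vs[OF a] by simp
    then show "vs ! a < n" using i c_less by simp
    have "(i, j) \<in> ?c\<^sup>* \<longleftrightarrow> (vs ! a, j) \<in> ?c\<^sup>*" for j
      using * c_sym[OF *] by (meson rtrancl_trans)
    then show "Cs ! a = ?c\<^sup>* `` {vs ! a}" by (auto simp: i(2))
  qed
  have virtual: "vs ! l < n" "vs ! Suc l < n" "vs ! l \<noteq> vs ! Suc l" if l: "Suc l < length vs" for l
  proof -
    have "Cs ! l \<noteq> Cs ! Suc l" using Cs(1) l len by (simp add: nth_eq_iff_index_eq)
    then show "vs ! l < n" "vs ! Suc l < n" "vs ! l \<noteq> vs ! Suc l"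
      using vs_component[of l] vs_component[of "Suc l"] vs_less[of l] vs_less[of "Suc l"] l len
      by auto
  qed
  have in_E: "{i, j} \<in> E \<longleftrightarrow> {i, j} \<in> ?C \<or> (\<exists>l. Suc l < length vs \<and> {i, j} = {vs ! l, vs ! Suc l})" for i j
    unfolding E by auto
  have edge: "i < n \<and> i \<noteq> j" if "{i, j} \<in> E" for i j
    using that unfolding in_E
  proof (elim disjE exE conjE)
    fix l assume "Suc l < length vs" "{i, j} = {vs ! l, vs ! Suc l}"
    then show ?thesis using virtual[of l] by (auto simp: doubleton_eq_iff)
  qed (simp add: cox_edge)
  have non_edge: "m i j = 2" if ij: "i < n" "j < n" "i \<noteq> j" "{i, j} \<notin> E" for i j
  proof -
    have "\<not> 3 \<le> m i j" using ij by (simp add: in_E cox_edge)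
    then show ?thesis
      using m_ge2[OF ij(1-3)] by (cases "m i j") (auto simp: numeral_eq_enat)
  qed
  have e_sym: "(j, i) \<in> ?e\<^sup>*" if "(i, j) \<in> ?e\<^sup>*" for i j
  proof -
    have "sym ?e" by (auto simp: sym_def insert_commute)
    then show ?thesis using that sym_rtrancl symD by metis
  qed
  have sub: "?c\<^sup>* \<subseteq> ?e\<^sup>*" by (rule rtrancl_mono) (auto simp: in_E)
  have from_0: "(vs ! 0, vs ! a) \<in> ?e\<^sup>*" if "a < length vs" for a
    using that
  proof (induction a)
    case (Suc a)
    then have "{vs ! a, vs ! Suc a} \<in> E" unfolding in_E by blast
    then have "(vs ! a, vs ! Suc a) \<in> ?e" by simp
    with Suc.IH Suc.prems show ?case by (meson Suc_lessD rtrancl.rtrancl_into_rtrancl)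
  qed simp
  have "(vs ! 0, i) \<in> ?e\<^sup>*" if "i < n" for i
  proof -
    have "?c\<^sup>* `` {i} \<in> set Cs"
      unfolding Cs(2) graph_components_def using that by (intro quotientI) simp
    then obtain a where a: "a < length Cs" "Cs ! a = ?c\<^sup>* `` {i}" by (metis in_set_conv_nth)
    then have "(vs ! a, i) \<in> ?c\<^sup>*" using vs[OF a(1)] c_sym by simp
    then have "(vs ! a, i) \<in> ?e\<^sup>*" using sub by blast
    then show ?thesis using from_0[of a] a(1) len by (simp add: rtrancl_trans)
  qed
  then have "(i, j) \<in> ?e\<^sup>*" if "i < n" "j < n" for i j
    using that e_sym by (meson rtrancl_trans)
  then show ?thesis
    using edge non_edge by unfold_locales auto
qed

theorem proposition2p4:
  fixes n :: nat and m :: "nat \<Rightarrow> nat \<Rightarrow> enat" and E :: "nat set set"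
  assumes "coxeter_matrix n m"
    and "connected_extension n m E"
  shows "(coxeter_group n m)\<lparr>carrier := alternating_subgroup n m\<rparr>
    \<cong> presented_group (alt_gens E) (alt_rels m E)"
  using connected_extension_graph[OF assms] by (rule coxeter_graph.alternating_presentation)

end
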